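(* Let $\alpha,\beta,\gamma\in\mathbf{C}$ satisfy $|1-\gamma|<\tfrac12$, $|\alpha+1-\gamma|<\tfrac12$, $|\beta+1-\gamma|<\tfrac12$ and $|\alpha+\beta+1-\gamma|<\tfrac12$. Let $\varphi^{(0)}_0$ be the Gauss hypergeometric function $\varphi^{(0)}_0(z)=F(\alpha,\beta,\gamma;z)=\sum_{n\ge 0}\frac{(\alpha)_n(\beta)_n}{(\gamma)_n\,n!}z^n$, continued analytically to the universal covering space $\mathfrak{U}$ of $\mathbf{P}^1-\{0,1,\infty\}$. Then for $z\in\mathfrak{U}$ $$\varphi^{(0)}_0(z)=1+\alpha\beta\sum_{\substack{k,n,s>0\\ k\ge n+s\\ n\ge s}}G_0(k,n,s;z)\,(1-\gamma)^{k-n-s}(\alpha+\beta+1-\gamma)^{n-s}\big((\alpha+1-\gamma)(\beta+1-\gamma)\big)^{s-1},$$ and the series on the right-hand side converges absolutely and uniformly on any compact subset $K$ of $\mathfrak{U}$.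
   Context: For integers $k_1,\dots,k_r\ge1$ the multiple polylogarithm of one variable is $\operatorname{Li}_{k_1,\dots,k_r}(z)=\sum_{m_1>\cdots>m_r>0}\frac{z^{m_1}}{m_1^{k_1}\cdots m_r^{k_r}}$ for $|z|<1$. It continues analytically to $\mathfrak{U}$, the universal covering space of $\mathbf{P}^1-\{0,1,\infty\}$. The branches on $\mathfrak{U}$ of the multiple polylogarithms and of $F$ are fixed by requiring that they be given by their power series at $0$ on a chosen lift $\mathfrak{I}\subset\mathfrak{U}$ of the real interval $(0,1)$ (the lift with $\arg z=\arg(1-z)=0$). For positive integers $k,n,s$, $$G_0(k,n,s;z)=\sum_{\substack{k_1+\cdots+k_n=k\\ k_1\ge2,\ k_2,\dots,k_n\ge1\\ \#\{i\,:\,k_i\ge2\}=s}}\operatorname{Li}_{k_1,\dots,k_n}(z).$$ $(a)_n=a(a+1)\cdots(a+n-1)$ is the Pochhammer symbol. Convention: $0^0=1$. *)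

theory Defs
  imports "HOL-Analysis.Analysis" "HOL-Complex_Analysis.Complex_Analysis"
begin

(* A universal covering U of S is a simply connected covering space; p is the covering projection.
   "simply_connected" includes path-connectedness.  P^1 - {0,1,infinity} is "- {0, 1}" in the
   complex plane. *)
definition universal_covering ::
  "'u::topological_space set \<Rightarrow> ('u \<Rightarrow> 'b::topological_space) \<Rightarrow> 'b set \<Rightarrow> bool" where
  "universal_covering U p S \<longleftrightarrow> simply_connected U \<and> covering_space U p S"

(* l parametrises a lift of the real interval (0,1) to U; the lift itself is l ` {0<..<1}. *)
definition unit_interval_lift ::
  "'u::topological_space set \<Rightarrow> ('u \<Rightarrow> complex) \<Rightarrow> (real \<Rightarrow> 'u) \<Rightarrow> bool" where
  "unit_interval_lift U p l \<longleftrightarrow>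
     continuous_on {0<..<1} l \<and> l ` {0<..<1} \<subseteq> U \<and> (\<forall>t\<in>{0<..<1}. p (l t) = complex_of_real t)"

(* Holomorphy with respect to the complex structure on U pulled back along p:
   near every point f is a holomorphic function of the coordinate p. *)
definition holomorphic_on_covering ::
  "'u::topological_space set \<Rightarrow> ('u \<Rightarrow> complex) \<Rightarrow> ('u \<Rightarrow> complex) \<Rightarrow> bool" where
  "holomorphic_on_covering U p f \<longleftrightarrow>
     (\<forall>u\<in>U. \<exists>V g. openin (top_of_set U) V \<and> u \<in> V \<and> open (p ` V) \<and>
        g holomorphic_on (p ` V) \<and> (\<forall>v\<in>V. f v = g (p v)))"

definition is_continuation ::
  "'u::topological_space set \<Rightarrow> ('u \<Rightarrow> complex) \<Rightarrow> (real \<Rightarrow> 'u) \<Rightarrow> (complex \<Rightarrow> complex)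
     \<Rightarrow> ('u \<Rightarrow> complex) \<Rightarrow> bool" where
  "is_continuation U p l f g \<longleftrightarrow>
     holomorphic_on_covering U p g \<and> (\<forall>t\<in>{0<..<1}. g (l t) = f (complex_of_real t))"

(* The continuation to U of a function f given near the interval (0,1), with the branch fixed by f
   on the lift l.  By the identity theorem its values on U do not depend on the choice; its values
   outside U are irrelevant. *)
definition continuation ::
  "'u::topological_space set \<Rightarrow> ('u \<Rightarrow> complex) \<Rightarrow> (real \<Rightarrow> 'u) \<Rightarrow> (complex \<Rightarrow> complex)
     \<Rightarrow> 'u \<Rightarrow> complex" where
  "continuation U p l f = (SOME g. is_continuation U p l f g)"

definition mpolylog_series :: "nat list \<Rightarrow> complex \<Rightarrow> complex" where
  "mpolylog_series ks z =
     (\<Sum>\<^sub>\<infinity>ms\<in>{ms. length ms = length ks \<and> sorted_wrt (>) ms \<and> (\<forall>m\<in>set ms. 0 < m)}.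
        z ^ hd ms / (\<Prod>i<length ks. of_nat (ms ! i) ^ (ks ! i)))"

definition gauss_series :: "complex \<Rightarrow> complex \<Rightarrow> complex \<Rightarrow> complex \<Rightarrow> complex" where
  "gauss_series \<alpha> \<beta> \<gamma> z =
     (\<Sum>n. pochhammer \<alpha> n * pochhammer \<beta> n / (pochhammer \<gamma> n * fact n) * z ^ n)"

definition admissible_indices :: "nat \<Rightarrow> nat \<Rightarrow> nat \<Rightarrow> nat list set" where
  "admissible_indices k n s =
     {ks. length ks = n \<and> sum_list ks = k \<and> 2 \<le> hd ks \<and> (\<forall>j\<in>set ks. 1 \<le> j) \<and>
          card {i. i < n \<and> 2 \<le> ks ! i} = s}"

definition G0 ::
  "'u::topological_space set \<Rightarrow> ('u \<Rightarrow> complex) \<Rightarrow> (real \<Rightarrow> 'u) \<Rightarrow> nat \<Rightarrow> nat \<Rightarrow> nat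
     \<Rightarrow> 'u \<Rightarrow> complex" where
  "G0 U p l k n s z = (\<Sum>ks\<in>admissible_indices k n s. continuation U p l (mpolylog_series ks) z)"

definition index_triples :: "(nat \<times> nat \<times> nat) set" where
  "index_triples = {(k, n, s). 0 < k \<and> 0 < n \<and> 0 < s \<and> n + s \<le> k \<and> s \<le> n}"

definition G0_term ::
  "'u::topological_space set \<Rightarrow> ('u \<Rightarrow> complex) \<Rightarrow> (real \<Rightarrow> 'u) \<Rightarrow>
     complex \<Rightarrow> complex \<Rightarrow> complex \<Rightarrow> 'u \<Rightarrow> nat \<times> nat \<times> nat \<Rightarrow> complex" where
  "G0_term U p l \<alpha> \<beta> \<gamma> z = (\<lambda>(k, n, s).
     G0 U p l k n s z * (1 - \<gamma>) ^ (k - n - s) * (\<alpha> + \<beta> + 1 - \<gamma>) ^ (n - s)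
       * ((\<alpha> + 1 - \<gamma>) * (\<beta> + 1 - \<gamma>)) ^ (s - 1))"

end

theory Submission
  imports Defs
begin

text \<open>
  Since \<open>d Li(k+1, \<dots>) = Li(k, \<dots>) dz/z\<close> and \<open>d Li(1, k\<^sub>2, \<dots>) = Li(k\<^sub>2, \<dots>) dz/(1-z)\<close>, the multiple
  polylogarithms continue to \<open>U\<close> one after the other, because locally exact forms on a simply
  connected space are exact. The same differential relations bound all of them simultaneously: a bound
  \<open>C\<close> valid for every index at one point becomes \<open>2 C\<close> on a small disc, so by connectedness and
  compactness there is a common bound on every compact set. As all parameters have modulus at most
  some \<open>r < 1/2\<close>, the weight of an index \<open>(k\<^sub>1, \<dots>, k\<^sub>n)\<close> is at most \<open>r ^ (k\<^sub>1 + \<dots> + k\<^sub>n - 2)\<close>,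
  and the sum of these over all indices is finite since \<open>r/(1-r) < 1\<close>. Hence the series converges to a
  holomorphic function on \<open>U\<close>. On the lift of \<open>(0,1)\<close> it can be compared with the Gauss series
  coefficientwise: summing the weights over all indices with largest summation variable \<open>m\<close> gives
  \<open>1/(m (m-x)) \<Prod>\<^sub>j\<^sub><\<^sub>m (1 + y/j + w/(j (j-x)))\<close> with \<open>x = 1-\<gamma>\<close>, \<open>y = \<alpha>+\<beta>+1-\<gamma>\<close>, \<open>w = (\<alpha>+1-\<gamma>)(\<beta>+1-\<gamma>)\<close>,
  and \<open>w - x y = \<alpha> \<beta>\<close> makes each factor equal to \<open>(j+\<alpha>)(j+\<beta>)/(j (j-1+\<gamma>))\<close>.
\<close>

subsection \<open>Monodromy\<close>

text \<open>Simple connectedness is the free homotopy of any two loops. For constant loops the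
  homotopy moves one point along a path to the other.\<close>

lemma simply_connected_path_connected:
  fixes S :: "'a::topological_space set"
  assumes "simply_connected S"
  shows "path_connected S"
  unfolding path_connected_component
proof (intro ballI)
  fix x y assume "x \<in> S" "y \<in> S"
  then have "homotopic_loops S (\<lambda>_. x) (\<lambda>_. y)"
    using assms[unfolded simply_connected_def, rule_format, of "\<lambda>_. x" "\<lambda>_. y"]
    by (auto simp: path_def pathstart_def pathfinish_def path_image_def)
  then show "path_component S x y"
    using homotopic_loops_imp_path_component_value[of S "\<lambda>_. x" "\<lambda>_. y" 0] by simp
qed

text \<open>\<open>d u v\<close> stands for the integral of a locally exact form from \<open>u\<close> to a nearby point \<open>v\<close>; it is
  meaningful only for \<open>v\<close> close to \<open>u\<close>.\<close>
locale additive_cocycle =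
  fixes U :: "'u::topological_space set" and d :: "'u \<Rightarrow> 'u \<Rightarrow> 'c::ab_group_add"
  assumes local_cocycle: "u \<in> U \<Longrightarrow> \<exists>N. openin (top_of_set U) N \<and> u \<in> N \<and> path_connected N \<and>
      (\<forall>v\<in>N. \<exists>M. openin (top_of_set U) M \<and> v \<in> M \<and> (\<forall>w\<in>M. d u w - d u v = d v w))"
begin

lemma d_self: "u \<in> U \<Longrightarrow> d u u = 0"
  using local_cocycle[of u] by force

section \<open>Primitives of a locally exact form along maps from intervals and squares\<close>

text \<open>\<open>\<Phi>\<close> is a primitive of the form pulled back along \<open>k\<close>.
  Increments are prescribed only between a point and those near it, because \<open>d\<close> has no
  meaning beyond; the filter is relative to \<open>Q\<close> so that closed pieces can be
  glued.\<close>

definition potential_along :: "('a::topological_space \<Rightarrow> 'u) \<Rightarrow> 'a set \<Rightarrow> ('a \<Rightarrow> 'c) \<Rightarrow> bool" where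
  "potential_along k Q \<Phi> \<longleftrightarrow>
     (\<forall>x\<in>Q. eventually (\<lambda>y. \<Phi> y - \<Phi> x = d (k x) (k y)) (at x within Q))"

lemma potential_along_cong:
  assumes "\<And>x. x \<in> Q \<Longrightarrow> k x = k' x" "\<And>x. x \<in> Q \<Longrightarrow> \<Phi> x = \<Phi>' x"
    and "potential_along k Q \<Phi>"
  shows "potential_along k' Q \<Phi>'"
  unfolding potential_along_def
proof
  fix x assume x: "x \<in> Q"
  have "eventually (\<lambda>y. \<Phi> y - \<Phi> x = d (k x) (k y)) (at x within Q)"
    using assms(3) x by (auto simp: potential_along_def)
  moreover have "eventually (\<lambda>y. y \<in> Q) (at x within Q)"
    by (simp add: eventually_at_filter)
  ultimately show "eventually (\<lambda>y. \<Phi>' y - \<Phi>' x = d (k' x) (k' y)) (at x within Q)"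
    by eventually_elim (use assms x in auto)
qed

text \<open>A closed piece that misses \<open>x\<close> stays away from \<open>x\<close>, so near
  each point only the pieces through it impose a condition.\<close>

lemma potential_along_Un:
  assumes "closed A" "closed B" "potential_along k A \<Phi>" "potential_along k B \<Phi>"
  shows "potential_along k (A \<union> B) \<Phi>"
proof -
  have triv: "eventually P (at x within C)" if "closed C" "x \<notin> C" for C x and P :: "'a \<Rightarrow> bool"
  proof -
    have "at x within C = bot" using that by (meson closed_limpt trivial_limit_within)
    then show ?thesis by simp
  qed
  show ?thesis
    unfolding potential_along_def at_within_union eventually_sup
  proof (intro ballI conjI)
    fix x
    show "eventually (\<lambda>y. \<Phi> y - \<Phi> x = d (k x) (k y)) (at x within A)"
      using assms(3) triv[OF assms(1)] by (cases "x \<in> A") (auto simp: potential_along_def)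
    show "eventually (\<lambda>y. \<Phi> y - \<Phi> x = d (k x) (k y)) (at x within B)"
      using assms(4) triv[OF assms(2)] by (cases "x \<in> B") (auto simp: potential_along_def)
  qed
qed

lemma potential_along_compose:
  assumes "potential_along k Q \<Phi>" "continuous_on Q' m" "m ` Q' \<subseteq> Q" "k ` Q \<subseteq> U"
  shows "potential_along (k \<circ> m) Q' (\<Phi> \<circ> m)"
  unfolding potential_along_def
proof
  fix x assume x: "x \<in> Q'"
  then have "m x \<in> Q" "k (m x) \<in> U" using assms by auto
  then obtain O1 where O1: "open O1" "m x \<in> O1"
    "\<And>y. y \<in> O1 \<Longrightarrow> y \<noteq> m x \<Longrightarrow> y \<in> Q \<Longrightarrow> \<Phi> y - \<Phi> (m x) = d (k (m x)) (k y)"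
    using assms(1) unfolding potential_along_def eventually_at_topological by metis
  have "eventually (\<lambda>y. m y \<in> O1) (at x within Q')"
    by (rule topological_tendstoD[OF _ O1(1,2)]) (use assms(2) x in \<open>auto simp: continuous_on_def\<close>)
  moreover have "eventually (\<lambda>y. y \<in> Q') (at x within Q')"
    by (simp add: eventually_at_filter)
  ultimately show "eventually (\<lambda>y. (\<Phi> \<circ> m) y - (\<Phi> \<circ> m) x = d ((k \<circ> m) x) ((k \<circ> m) y)) (at x within Q')"
  proof eventually_elim
    case (elim y)
    \<comment> \<open>The filter leaves out \<open>x\<close> itself but not other \<open>y\<close>
      with \<open>m y = m x\<close>; for those \<open>d u u = 0\<close> is needed.\<close>
    then show ?case
      using O1(3)[of "m y"] assms(3) d_self[OF \<open>k (m x) \<in> U\<close>] by (cases "m y = m x") auto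
  qed
qed

lemma potential_along_add:
  assumes "potential_along k Q \<Phi>"
  shows "potential_along k Q (\<lambda>x. \<Phi> x + c)"
  using assms by (simp add: potential_along_def)

lemma potential_along_unique:
  assumes "connected Q" "potential_along k Q \<Phi>" "potential_along k Q \<Psi>" "x \<in> Q" "y \<in> Q"
  shows "\<Phi> x - \<Psi> x = \<Phi> y - \<Psi> y"
proof (rule connected_local_const[OF assms(1,4,5)])
  show "\<forall>x\<in>Q. eventually (\<lambda>y. \<Phi> x - \<Psi> x = \<Phi> y - \<Psi> y) (at x within Q)"
  proof
    fix x assume "x \<in> Q"
    then have "eventually (\<lambda>y. \<Phi> y - \<Phi> x = d (k x) (k y)) (at x within Q)"
      "eventually (\<lambda>y. \<Psi> y - \<Psi> x = d (k x) (k y)) (at x within Q)"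
      using assms by (auto simp: potential_along_def)
    then show "eventually (\<lambda>y. \<Phi> x - \<Psi> x = \<Phi> y - \<Psi> y) (at x within Q)"
    proof eventually_elim
      case (elim y)
      then have "\<Phi> y - \<Phi> x = \<Psi> y - \<Psi> x" by simp
      then show ?case by (simp add: algebra_simps)
    qed
  qed
qed

text \<open>Read with \<open>u\<close> fixed, the cocycle relation says that \<open>d u\<close> is
  itself a primitive on \<open>N\<close>; here it is pulled back along \<open>k\<close>.\<close>

lemma potential_along_local:
  assumes u: "u \<in> U" and N: "openin (top_of_set U) N"
      "\<And>v. v \<in> N \<Longrightarrow> \<exists>M. openin (top_of_set U) M \<and> v \<in> M \<and> (\<forall>w\<in>M. d u w - d u v = d v w)"
    and k: "continuous_on Q k" "k ` Q \<subseteq> N"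
  shows "potential_along k Q (\<lambda>x. d u (k x))"
  unfolding potential_along_def
proof
  fix x assume x: "x \<in> Q"
  then have "k x \<in> N" using k(2) by auto
  then obtain M where M: "openin (top_of_set U) M" "k x \<in> M"
    "\<And>w. w \<in> M \<Longrightarrow> d u w - d u (k x) = d (k x) w"
    using N(2)[of "k x"] by auto
  then obtain O1 where O1: "open O1" "M = U \<inter> O1" by (auto simp: openin_open)
  have "eventually (\<lambda>y. k y \<in> O1) (at x within Q)"
    by (rule topological_tendstoD[OF _ O1(1)]) (use k(1) x O1(2) M(2) in \<open>auto simp: continuous_on_def\<close>)
  moreover have "eventually (\<lambda>y. y \<in> Q) (at x within Q)"
    by (simp add: eventually_at_filter)
  ultimately show "eventually (\<lambda>y. d u (k y) - d u (k x) = d (k x) (k y)) (at x within Q)"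
  proof eventually_elim
    case (elim y)
    then show ?case using M(3)[of "k y"] O1 k(2) openin_imp_subset[OF N(1)] by auto
  qed
qed

text \<open>On the connected intersection the two potentials differ by a constant \<open>c\<close>,
  which is absorbed into the second one. If the pieces are disjoint, any \<open>c\<close> will
  do.\<close>

lemma potential_along_glue:
  assumes "closed A" "closed B" "connected (A \<inter> B)"
    and "potential_along k A \<Phi>" "potential_along k B \<Psi>"
  shows "\<exists>\<Theta>. potential_along k (A \<union> B) \<Theta>"
proof -
  obtain c where c: "\<And>x. x \<in> A \<inter> B \<Longrightarrow> \<Phi> x - \<Psi> x = c"
  proof (cases "A \<inter> B = {}")
    case False
    then obtain x0 where x0: "x0 \<in> A \<inter> B" by blast
    have sub: "potential_along k (A \<inter> B) \<Phi>" "potential_along k (A \<inter> B) \<Psi>"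
      using assms(4,5) unfolding potential_along_def
      by (meson IntD1 IntD2 at_le filter_leD inf_le1 inf_le2)+
    show thesis
      by (rule that[of "\<Phi> x0 - \<Psi> x0"]) (rule potential_along_unique[OF assms(3) sub _ x0])
  qed auto
  define \<Theta> where "\<Theta> x = (if x \<in> A then \<Phi> x else \<Psi> x + c)" for x
  have "potential_along k A \<Theta>"
    by (rule potential_along_cong[OF _ _ assms(4)]) (auto simp: \<Theta>_def)
  moreover have "potential_along k B \<Theta>"
    by (rule potential_along_cong[OF _ _ potential_along_add[OF assms(5), of c]])
      (auto simp: \<Theta>_def simp flip: c)
  ultimately show ?thesis using potential_along_Un assms by blast
qed

text \<open>Two successive bisections, first in the second coordinate and then in the first, reduce
  the square to rectangles small enough to be mapped into one cocycle neighbourhood.\<close>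

lemma potential_along_square:
  fixes k :: "real \<times> real \<Rightarrow> 'u"
  assumes k: "continuous_on ({0..1} \<times> {0..1}) k" "k ` ({0..1} \<times> {0..1}) \<subseteq> U"
  shows "\<exists>\<Phi>. potential_along k ({0..1} \<times> {0..1}) \<Phi>"
proof -
  \<comment> \<open>The small intervals of a bisection may stick out of \<open>{0..1}\<close>, hence
    the clipping. Clipped rectangles are convex, so every overlap is connected.\<close>
  define R where "R a b c e = ({a..b} \<inter> {0..1}) \<times> ({c..e} \<inter> {0..1})" for a b c e :: real
  define P where "P a b c e \<longleftrightarrow> (\<exists>\<Phi>. potential_along k (R a b c e) \<Phi>)" for a b c e
  have closed_R: "closed (R a b c e)" for a b c e
    unfolding R_def by (intro closed_Times closed_Int closed_real_atLeastAtMost)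
  have connected_R: "connected (R a b c e)" for a b c e
    unfolding R_def by (intro convex_connected convex_Times convex_Int) auto
  have glue: "P a b c e" if pieces: "P a1 b1 c1 e1" "P a2 b2 c2 e2" "R a b c e = R a1 b1 c1 e1 \<union> R a2 b2 c2 e2"
      "R a1 b1 c1 e1 \<inter> R a2 b2 c2 e2 = R a3 b3 c3 e3"
    for a b c e a1 b1 c1 e1 a2 b2 c2 e2 a3 b3 c3 e3
  proof -
    obtain \<Phi> \<Psi> where "potential_along k (R a1 b1 c1 e1) \<Phi>" "potential_along k (R a2 b2 c2 e2) \<Psi>"
      using pieces unfolding P_def by blast
    moreover have "connected (R a1 b1 c1 e1 \<inter> R a2 b2 c2 e2)" using pieces(4) connected_R by simp
    ultimately show ?thesis using potential_along_glue[OF closed_R closed_R] pieces(3)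
      unfolding P_def by metis
  qed
  have mono: "P a b c e" if "P a' b' c' e'" "R a b c e \<subseteq> R a' b' c' e'" for a b c e a' b' c' e'
    using that unfolding P_def potential_along_def by (meson at_le filter_leD subsetD)
  have loc: "\<exists>\<delta>>0. \<forall>a b c e. a \<le> s \<and> s \<le> b \<and> b - a < \<delta> \<and> c \<le> t \<and> t \<le> e \<and> e - c < \<delta> \<longrightarrow> P a b c e"
    if "0 \<le> s" "s \<le> 1" "0 \<le> t" "t \<le> 1" for s t
  proof -
    have st: "(s, t) \<in> {0..1} \<times> {0..1}" using that by auto
    then have u: "k (s, t) \<in> U" using k by auto
    then obtain N where N: "openin (top_of_set U) N" "k (s, t) \<in> N"
      "\<And>v. v \<in> N \<Longrightarrow> \<exists>M. openin (top_of_set U) M \<and> v \<in> M \<and> (\<forall>w\<in>M. d (k (s, t)) w - d (k (s, t)) v = d v w)"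
      using local_cocycle[OF u] by metis
    obtain O1 where O1: "open O1" "N = U \<inter> O1" using N(1) by (auto simp: openin_open)
    have "openin (top_of_set ({0..1} \<times> {0..1})) (({0..1} \<times> {0..1}) \<inter> k -` O1)"
      using continuous_openin_preimage_gen[OF k(1) O1(1)] .
    then obtain O2 where O2: "open O2" "({0..1} \<times> {0..1}) \<inter> k -` O1 = ({0..1} \<times> {0..1}) \<inter> O2"
      unfolding openin_open by metis
    have "(s, t) \<in> O2" using O2(2) st N(2) O1(2) by blast
    then obtain r where r0: "r > 0" "\<And>y. dist y (s, t) < r \<Longrightarrow> y \<in> O2"
      using O2(1) unfolding open_dist by metis
    have r: "k x \<in> O1" if "x \<in> {0..1} \<times> {0..1}" "dist x (s, t) < r" for x
      using that r0(2)[of x] O2(2) by blast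
    show ?thesis
    proof (intro exI conjI allI impI)
      \<comment> \<open>Two coordinate differences below \<open>r / 2\<close> add up to a distance
        below \<open>r\<close>.\<close>
      show "r / 2 > 0" using r0 by simp
      fix a b c e assume *: "a \<le> s \<and> s \<le> b \<and> b - a < r / 2 \<and> c \<le> t \<and> t \<le> e \<and> e - c < r / 2"
      have "k x \<in> N" if x: "x \<in> R a b c e" for x
      proof -
        obtain x1 x2 where x12: "x = (x1, x2)" by force
        have "dist x (s, t) \<le> \<bar>x1 - s\<bar> + \<bar>x2 - t\<bar>"
          unfolding x12 dist_Pair_Pair dist_real_def using sqrt_sum_squares_le_sum_abs by auto
        also have "\<dots> < r" using x * unfolding x12 R_def by auto
        finally have "k x \<in> O1" using r[of x] x unfolding R_def x12 by auto
        moreover have "k x \<in> U" using k(2) x unfolding R_def x12 by auto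
        ultimately show ?thesis using O1 by simp
      qed
      moreover have "continuous_on (R a b c e) k"
        by (rule continuous_on_subset[OF k(1)]) (auto simp: R_def)
      ultimately show "P a b c e"
        unfolding P_def using potential_along_local[OF u N(1) N(3)] by blast
    qed
  qed
  \<comment> \<open>Bisection in the second coordinate with \<open>s\<close> fixed: strips of full
    height around \<open>s\<close> have a potential once they are narrow enough. Neighbouring pieces
    overlap in the degenerate rectangle over \<open>c2\<close>.\<close>
  have strip: "\<exists>\<delta>>0. \<forall>a b. a \<le> s \<and> s \<le> b \<and> b - a < \<delta> \<longrightarrow> P a b c e"
    if s: "0 \<le> s" "s \<le> 1" and ce: "c = 0" "e = 1" for s c e
  proof -
    define Q where "Q c e \<longleftrightarrow> (\<exists>\<delta>>0. \<forall>a b. a \<le> s \<and> s \<le> b \<and> b - a < \<delta> \<longrightarrow> P a b c e)" for c e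
    have "0 \<le> (1::real)" by simp
    then have "Q 0 1"
    proof (induction rule: Bolzano)
      case (trans c1 c2 c3)
      obtain \<delta>1 \<delta>2 where \<delta>: "\<delta>1 > 0" "\<delta>2 > 0"
        "\<And>a b. a \<le> s \<and> s \<le> b \<and> b - a < \<delta>1 \<Longrightarrow> P a b c1 c2"
        "\<And>a b. a \<le> s \<and> s \<le> b \<and> b - a < \<delta>2 \<Longrightarrow> P a b c2 c3"
        using trans(1,2) unfolding Q_def by blast
      have "P a b c1 c3" if "a \<le> s \<and> s \<le> b \<and> b - a < min \<delta>1 \<delta>2" for a b
        by (rule glue[of a b c1 c2 a b c2 c3 a b c1 c3 a b c2 c2])
          (use \<delta> that trans in \<open>auto simp: R_def\<close>)
      then show ?case unfolding Q_def using \<delta>(1,2) by (intro exI[of _ "min \<delta>1 \<delta>2"]) auto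
    next
      case (local t)
      obtain \<delta> where "\<delta> > 0" "\<And>a b c e. a \<le> s \<and> s \<le> b \<and> b - a < \<delta> \<and> c \<le> t \<and> t \<le> e \<and> e - c < \<delta> \<Longrightarrow> P a b c e"
        using loc[OF s local] by blast
      then show ?case unfolding Q_def by (intro exI[of _ \<delta>]) auto
    qed
    then show ?thesis unfolding Q_def using ce by simp
  qed
  define T where "T a b \<longleftrightarrow> P a b 0 1" for a b
  have "0 \<le> (1::real)" by simp
  then have "T 0 1"
  proof (induction rule: Bolzano)
    case (trans a b c)
    show ?case unfolding T_def
      by (rule glue[of a b 0 1 b c 0 1 a c 0 1 b b 0 1])
        (use trans in \<open>auto simp: R_def T_def\<close>)
  next
    case (local s)
    then show ?case using strip unfolding T_def by auto
  qed
  then show ?thesis by (simp add: P_def R_def T_def)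
qed

text \<open>The path is viewed as a map on the square that does not depend on the first coordinate,
  which spares a separate bisection of the interval.\<close>

lemma potential_along_path:
  assumes "path g" "path_image g \<subseteq> U"
  shows "\<exists>\<Phi>. potential_along g {0..1} \<Phi>"
proof -
  have "continuous_on ({0..1::real} \<times> {0..1}) (g \<circ> snd)"
    using assms(1) unfolding path_def
    by (intro continuous_on_compose[OF continuous_on_snd[OF continuous_on_id]]) (auto elim: continuous_on_subset)
  moreover have gU: "(g \<circ> snd) ` ({0..1::real} \<times> {0..1}) \<subseteq> U"
    using assms(2) by (auto simp: path_image_def)
  ultimately obtain \<Phi> where \<Phi>: "potential_along (g \<circ> snd) ({0..1::real} \<times> {0..1}) \<Phi>"
    using potential_along_square by blast
  have "potential_along ((g \<circ> snd) \<circ> Pair (0::real)) {0..1} (\<Phi> \<circ> Pair 0)"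
    by (rule potential_along_compose[OF \<Phi> _ _ gU])
      (auto intro!: continuous_intros)
  then show ?thesis by (auto simp: comp_def)
qed

text \<open>A free homotopy contracts \<open>g\<close> to a constant loop. As its two sides
  \<open>h (s, 0)\<close> and \<open>h (s, 1)\<close> coincide,
  \<open>\<Psi> (s, 1) - \<Psi> (s, 0)\<close> is independent of \<open>s\<close>; it is the
  increment along \<open>g\<close> for \<open>s = 0\<close> and vanishes for
  \<open>s = 1\<close>.\<close>

lemma potential_along_loop:
  assumes "simply_connected U" "path g" "path_image g \<subseteq> U" "pathfinish g = pathstart g"
    and \<Phi>: "potential_along g {0..1} \<Phi>"
  shows "\<Phi> 1 = \<Phi> 0"
proof -
  let ?S = "{0..1::real} \<times> {0..1::real}"
  define b where "b = pathstart g"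
  have b: "b \<in> U" using assms(3) by (auto simp: b_def)
  have "homotopic_loops U g (\<lambda>_. b)"
    using assms(1)[unfolded simply_connected_def, rule_format, of g "\<lambda>_. b"] assms(2,3,4) b
    by (auto simp: path_def pathstart_def pathfinish_def path_image_def)
  then obtain h where h: "continuous_on ?S h" "h ` ?S \<subseteq> U"
    "\<And>x. x \<in> {0..1} \<Longrightarrow> h (0, x) = g x" "\<And>x. x \<in> {0..1} \<Longrightarrow> h (1, x) = b"
    "\<And>s. s \<in> {0..1} \<Longrightarrow> h (s, 1) = h (s, 0)"
    unfolding homotopic_loops pathstart_def pathfinish_def comp_def image_subset_iff_funcset by blast
  obtain \<Psi> where \<Psi>: "potential_along h ?S \<Psi>" using potential_along_square[OF h(1,2)] by blast
  have sub: "potential_along (h \<circ> m) {0..1} (\<Psi> \<circ> m)" if "continuous_on {0..1} m" "m ` {0..1} \<subseteq> ?S" for m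
    using potential_along_compose[OF \<Psi> that h(2)] .
  have "potential_along (h \<circ> (\<lambda>s. (s, 0))) {0..1} (\<Psi> \<circ> (\<lambda>s. (s, 1)))"
    by (rule potential_along_cong[OF _ _ sub[of "\<lambda>s. (s, 1)"]]) (auto intro!: continuous_intros simp: h(5))
  moreover have "potential_along (h \<circ> (\<lambda>s. (s, 0))) {0..1} (\<Psi> \<circ> (\<lambda>s. (s, 0)))"
    by (rule sub) (auto intro!: continuous_intros)
  ultimately have 1: "\<Psi> (0, 1) - \<Psi> (0, 0) = \<Psi> (1, 1) - \<Psi> (1, 0)"
    using potential_along_unique[of "{0..1::real}" _ "\<Psi> \<circ> (\<lambda>s. (s, 1))" "\<Psi> \<circ> (\<lambda>s. (s, 0))" 0 1] by auto
  have "potential_along (\<lambda>_. b) {0..1} (\<Psi> \<circ> Pair 1)"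
    by (rule potential_along_cong[OF _ _ sub[of "Pair 1"]]) (auto intro!: continuous_intros simp: h(4))
  moreover have "potential_along (\<lambda>_. b) {0..1::real} (\<lambda>_. 0)"
    by (simp add: potential_along_def d_self b)
  ultimately have 2: "\<Psi> (1, 1) = \<Psi> (1, 0)"
    using potential_along_unique[of "{0..1::real}" _ "\<Psi> \<circ> Pair 1" "\<lambda>_. 0" 0 1] by auto
  have "potential_along g {0..1} (\<Psi> \<circ> Pair 0)"
    by (rule potential_along_cong[OF _ _ sub[of "Pair 0"]]) (auto intro!: continuous_intros simp: h(3))
  then have "\<Phi> 0 - \<Psi> (0, 0) = \<Phi> 1 - \<Psi> (0, 1)"
    using potential_along_unique[OF _ \<Phi>, of "\<Psi> \<circ> Pair 0" 0 1] by auto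
  then show ?thesis using 1 2 by simp
qed

section \<open>Path independence and the global primitive\<close>

text \<open>The loop \<open>g\<close> followed by \<open>h\<close> backwards has increment zero, and
  its halves are compared with \<open>\<Phi>\<close> and \<open>\<Psi>\<close> after
  reparametrisation.\<close>

lemma potential_along_endpoints:
  assumes sc: "simply_connected U"
    and g: "path g" "path_image g \<subseteq> U" "potential_along g {0..1} \<Phi>"
    and h: "path h" "path_image h \<subseteq> U" "potential_along h {0..1} \<Psi>"
    and eq: "pathstart g = pathstart h" "pathfinish g = pathfinish h"
  shows "\<Phi> 1 - \<Phi> 0 = \<Psi> 1 - \<Psi> 0"
proof -
  let ?l = "g +++ reversepath h"
  have l: "path ?l" "path_image ?l \<subseteq> U" "pathfinish ?l = pathstart ?l"
    using g h eq by (auto simp: path_image_join)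
  obtain \<Theta> where \<Theta>: "potential_along ?l {0..1} \<Theta>" using potential_along_path l by blast
  have lU: "?l ` {0..1} \<subseteq> U" using l(2) by (simp add: path_image_def)
  have "potential_along (?l \<circ> (\<lambda>t. t / 2)) {0..1} (\<Theta> \<circ> (\<lambda>t. t / 2))"
    by (rule potential_along_compose[OF \<Theta> _ _ lU]) (auto intro!: continuous_intros)
  then have "potential_along g {0..1} (\<Theta> \<circ> (\<lambda>t. t / 2))"
    by (rule potential_along_cong[rotated 2]) (auto simp: joinpaths_def)
  then have 1: "\<Phi> 0 - \<Theta> 0 = \<Phi> 1 - \<Theta> (1/2)"
    using potential_along_unique[OF _ g(3), of _ 0 1] by fastforce
  have "potential_along (?l \<circ> (\<lambda>t. 1 - t / 2)) {0..1} (\<Theta> \<circ> (\<lambda>t. 1 - t / 2))"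
    by (rule potential_along_compose[OF \<Theta> _ _ lU]) (auto intro!: continuous_intros)
  then have "potential_along h {0..1} (\<Theta> \<circ> (\<lambda>t. 1 - t / 2))"
    by (rule potential_along_cong[rotated 2])
      (use eq in \<open>auto simp: joinpaths_def reversepath_def pathfinish_def algebra_simps\<close>)
  then have 2: "\<Psi> 0 - \<Theta> 1 = \<Psi> 1 - \<Theta> (1/2)"
    using potential_along_unique[OF _ h(3), of "\<Theta> \<circ> (\<lambda>t. 1 - t / 2)" 0 1] by force
  have "\<Theta> 1 = \<Theta> 0" by (rule potential_along_loop[OF sc l \<Theta>])
  moreover have "\<Phi> 1 - \<Phi> 0 = \<Theta> (1/2) - \<Theta> 0" using 1 by (simp add: algebra_simps)
  moreover have "\<Psi> 1 - \<Psi> 0 = \<Theta> (1/2) - \<Theta> 1" using 2 by (simp add: algebra_simps)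
  ultimately show ?thesis by simp
qed

text \<open>\<open>F u\<close> is the increment along any path from a base point to
  \<open>u\<close>. Appending a path from \<open>u\<close> to \<open>v\<close> inside the
  path-connected \<open>N\<close> adds exactly \<open>d u v\<close>.\<close>

theorem global_potential:
  assumes sc: "simply_connected U"
  shows "\<exists>F. \<forall>u\<in>U. \<exists>N. openin (top_of_set U) N \<and> u \<in> N \<and> (\<forall>v\<in>N. F v - F u = d u v)"
proof (cases "U = {}")
  case False
  then obtain b where b: "b \<in> U" by blast
  have pc: "path_connected U" using sc by (rule simply_connected_path_connected)
  define rel where "rel u c \<longleftrightarrow> (\<exists>g \<Phi>. path g \<and> path_image g \<subseteq> U \<and> pathstart g = b \<and> pathfinish g = u \<and>
    potential_along g {0..1} \<Phi> \<and> \<Phi> 1 - \<Phi> 0 = c)" for u c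
  define F where "F u = (SOME c. rel u c)" for u
  have ex: "\<exists>c. rel u c" if u: "u \<in> U" for u
    using pc b u potential_along_path unfolding rel_def path_connected_def by metis
  have rel_unique: "c = c'" if "rel u c" "rel u c'" for u c c'
    using that potential_along_endpoints[OF sc] unfolding rel_def by metis
  have F: "F u = c" if "rel u c" for u c
    using that rel_unique someI unfolding F_def by metis
  have relF: "rel u (F u)" if "u \<in> U" for u
    using ex[OF that] F by auto
  show ?thesis
  proof (rule exI[of _ F], rule ballI)
    fix u assume u: "u \<in> U"
    obtain N where N: "openin (top_of_set U) N" "u \<in> N" "path_connected N"
      "\<And>v. v \<in> N \<Longrightarrow> \<exists>M. openin (top_of_set U) M \<and> v \<in> M \<and> (\<forall>w\<in>M. d u w - d u v = d v w)"
      using local_cocycle[OF u] by metis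
    obtain g \<Phi> where g: "path g" "path_image g \<subseteq> U" "pathstart g = b" "pathfinish g = u"
      "potential_along g {0..1} \<Phi>" "\<Phi> 1 - \<Phi> 0 = F u"
      using relF[OF u] unfolding rel_def by blast
    have "F v - F u = d u v" if v: "v \<in> N" for v
    proof -
      obtain h where h: "path h" "path_image h \<subseteq> N" "pathstart h = u" "pathfinish h = v"
        using N(2,3) v unfolding path_connected_def by blast
      have NU: "N \<subseteq> U" using N(1) by (rule openin_imp_subset)
      have hpot: "potential_along h {0..1} (\<lambda>x. d u (h x))"
        by (rule potential_along_local[OF u N(1,4)]) (use h in \<open>auto simp: path_def path_image_def\<close>)
      \<comment> \<open>The potential along \<open>g\<close> continued along \<open>h\<close>; the
        offset \<open>\<Phi> 1\<close> makes both formulas agree at \<open>1/2\<close>, where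
        \<open>d u u = 0\<close>.\<close>
      define \<Theta> where "\<Theta> t = (if t \<le> 1/2 then \<Phi> (2 * t) else \<Phi> 1 + d u (h (2 * t - 1)))" for t :: real
      have "potential_along (g \<circ> (\<lambda>t. 2 * t)) {0..1/2} (\<Phi> \<circ> (\<lambda>t. 2 * t))"
        by (rule potential_along_compose[OF g(5)])
          (use g(2) in \<open>auto intro!: continuous_intros simp: path_image_def\<close>)
      then have 1: "potential_along (g +++ h) {0..1/2} \<Theta>"
        by (rule potential_along_cong[rotated 2]) (auto simp: joinpaths_def \<Theta>_def)
      have "potential_along (h \<circ> (\<lambda>t. 2 * t - 1)) {1/2..1} ((\<lambda>x. d u (h x) + \<Phi> 1) \<circ> (\<lambda>t. 2 * t - 1))"
        by (rule potential_along_compose[OF potential_along_add[OF hpot]])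
          (use h(2) NU in \<open>auto intro!: continuous_intros simp: path_image_def\<close>)
      then have 2: "potential_along (g +++ h) {1/2..1} \<Theta>"
      proof (rule potential_along_cong[rotated 2], goal_cases)
        case (1 x)
        show ?case
        proof (cases "x = 1/2")
          case True
          then show ?thesis using g(4) h(3)
            unfolding True by (simp add: joinpaths_def pathfinish_def pathstart_def)
        qed (use 1 in \<open>auto simp: joinpaths_def\<close>)
      next
        case (2 x)
        show ?case
        proof (cases "x = 1/2")
          case True
          then show ?thesis using h(3) d_self[OF u]
            unfolding True by (simp add: \<Theta>_def pathstart_def)
        qed (use 2 in \<open>auto simp: \<Theta>_def add.commute\<close>)
      qed
      have "{0..1/2} \<union> {1/2..1} = {0..1::real}" by auto
      then have "potential_along (g +++ h) {0..1} \<Theta>"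
        using potential_along_Un[OF _ _ 1 2] by simp
      moreover have "\<Theta> 1 - \<Theta> 0 = F u + d u v"
        using g(6) h(4) by (simp add: \<Theta>_def pathfinish_def algebra_simps)
      ultimately have "rel v (F u + d u v)"
        unfolding rel_def using g h NU
        by (intro exI[of _ "g +++ h"] exI[of _ \<Theta>]) (auto simp: path_image_join)
      then show ?thesis using F by simp
    qed
    then show "\<exists>N. openin (top_of_set U) N \<and> u \<in> N \<and> (\<forall>v\<in>N. F v - F u = d u v)"
      using N by blast
  qed
qed auto

end

subsection \<open>Holomorphic functions on coverings of plane domains\<close>

locale complex_covering =
  fixes U :: "'u::topological_space set" and p :: "'u \<Rightarrow> complex" and S :: "complex set"
  assumes simply_connected_U: "simply_connected U"
    and covering: "covering_space U p S"
    and open_S: "open S"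
begin

text \<open>Charts are sheets over discs because discs are convex: holomorphic functions on them
  have primitives. The local inverse \<open>q\<close> turns a function on \<open>U\<close> into a
  function of one complex variable.\<close>

definition chart :: "'u set \<Rightarrow> complex \<Rightarrow> real \<Rightarrow> (complex \<Rightarrow> 'u) \<Rightarrow> bool" where
  "chart V c r q \<longleftrightarrow> openin (top_of_set U) V \<and> ball c r \<subseteq> S \<and> homeomorphism V (ball c r) p q"

lemma continuous_p: "continuous_on U p"
  using covering by (rule covering_space_imp_continuous)

lemma connected_U: "connected U"
  using simply_connected_U simply_connected_path_connected path_connected_imp_connected by blast

text \<open>A sheet of the local homeomorphism is cut down to the part over a disc. The bound
  \<open>e\<close> serves later to keep the disc small compared with the distance of
  \<open>p u\<close> from \<open>0\<close> and \<open>1\<close>.\<close>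

lemma chart_exists:
  assumes "u \<in> U" "e > 0"
  obtains V r q where "0 < r" "r \<le> e" "u \<in> V" "chart V (p u) r q"
proof -
  obtain T W q where W: "u \<in> T" "openin (top_of_set U) T" "p u \<in> W" "openin (top_of_set S) W"
    "homeomorphism T W p q"
    using covering_space_local_homeomorphism[OF covering assms(1)] by metis
  have "open W" using W(4) open_S by (simp add: openin_open_eq)
  then obtain r' where r': "r' > 0" "ball (p u) r' \<subseteq> W" using W(3) openE by blast
  define r where "r = min r' e"
  define V where "V = T \<inter> (U \<inter> p -` ball (p u) r)"
  have r: "0 < r" "r \<le> e" "ball (p u) r \<subseteq> W" using r' assms(2) by (auto simp: r_def)
  have "openin (top_of_set U) V"
    unfolding V_def by (intro openin_Int W(2) continuous_openin_preimage_gen continuous_p open_ball)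
  moreover have "homeomorphism V (ball (p u) r) p q"
  proof (rule homeomorphism_of_subsets[OF W(5) _ r(3)])
    show "V \<subseteq> T" by (simp add: V_def)
    have "T \<subseteq> U" using W(2) by (rule openin_imp_subset)
    moreover have "p ` T = W" using W(5) by (simp add: homeomorphism_def)
    ultimately show "p ` V = ball (p u) r" using r(3) unfolding V_def by blast
  qed
  moreover have "ball (p u) r \<subseteq> S" using r(3) W(4) openin_imp_subset by blast
  ultimately have "chart V (p u) r q" by (simp add: chart_def)
  moreover have "u \<in> V" using W(1) assms(1) r(1) by (simp add: V_def)
  ultimately show thesis using that r by blast
qed

lemma chart_at:
  assumes "u \<in> U"
  obtains V r q where "u \<in> V" "chart V (p u) r q"
  using chart_exists[OF assms zero_less_one] by metis

context
  fixes V c r q assumes ch: "chart V c r q"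
begin

lemma chart_subset: "V \<subseteq> U"
  using ch openin_imp_subset unfolding chart_def by blast

lemma chart_openin: "openin (top_of_set U) V"
  using ch unfolding chart_def by blast

lemma chart_ball: "ball c r \<subseteq> S"
  using ch unfolding chart_def by blast

lemma chart_q: "x \<in> ball c r \<Longrightarrow> q x \<in> V \<and> p (q x) = x"
  using ch unfolding chart_def homeomorphism_def by blast

lemma chart_p: "v \<in> V \<Longrightarrow> p v \<in> ball c r \<and> q (p v) = v"
  using ch unfolding chart_def homeomorphism_def by blast

lemma chart_continuous_q: "continuous_on (ball c r) q"
  using ch unfolding chart_def homeomorphism_def by blast

lemma chart_image: "p ` V = ball c r" "q ` ball c r = V"
  using ch unfolding chart_def homeomorphism_def by blast+

lemma chart_vimage_open:
  assumes "openin (top_of_set U) N"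
  shows "open {x \<in> ball c r. q x \<in> N}"
proof -
  obtain N' where N': "open N'" "N = U \<inter> N'" using assms by (auto simp: openin_open)
  have "openin (top_of_set (ball c r)) (ball c r \<inter> q -` N')"
    using continuous_openin_preimage_gen[OF chart_continuous_q N'(1)] .
  then have "open (ball c r \<inter> q -` N')" by (simp add: openin_open_eq)
  moreover have "{x \<in> ball c r. q x \<in> N} = ball c r \<inter> q -` N'"
    using chart_q chart_subset N'(2) by auto
  ultimately show ?thesis by simp
qed

text \<open>Near \<open>q x\<close> the function factors as \<open>g\<close> after \<open>p\<close>,
  and \<open>p\<close> inverts \<open>q\<close>; so \<open>f\<close> after \<open>q\<close> has the
  derivative of \<open>g\<close> at \<open>x\<close>.\<close>

lemma holomorphic_chart:
  assumes "holomorphic_on_covering U p f"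
  shows "(f \<circ> q) holomorphic_on ball c r"
  unfolding holomorphic_on_def
proof
  fix x assume x: "x \<in> ball c r"
  then have "q x \<in> U" using chart_q chart_subset by blast
  then obtain N g where N: "openin (top_of_set U) N" "q x \<in> N" "open (p ` N)"
    "g holomorphic_on (p ` N)" "\<And>v. v \<in> N \<Longrightarrow> f v = g (p v)"
    using assms unfolding holomorphic_on_covering_def by metis
  have "p (q x) \<in> p ` N" using N(2) by blast
  then have "x \<in> p ` N" using chart_q[OF x] by simp
  then obtain D where "(g has_field_derivative D) (at x)"
    using N(3,4) unfolding holomorphic_on_open[OF N(3)] by blast
  then have "((f \<circ> q) has_field_derivative D) (at x)"
    by (rule has_field_derivative_transform_within_open[OF _ chart_vimage_open[OF N(1)]])
      (use x N chart_q in auto)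
  then show "(f \<circ> q) field_differentiable (at x within ball c r)"
    using field_differentiable_at_within field_differentiable_def by blast
qed

text \<open>By continuity the lift stays in the sheet \<open>V\<close> for a while, and there
  \<open>q\<close> inverts \<open>p\<close>; so in the chart the lift is a real segment.\<close>

lemma lift_in_chart:
  assumes "unit_interval_lift U p l" "0 < t" "t < 1" "l t \<in> V"
  obtains \<delta> where "\<delta> > 0" "\<And>s. \<bar>s - t\<bar> < \<delta> \<Longrightarrow> 0 < s \<and> s < 1 \<and> of_real s \<in> ball c r \<and> l s = q (of_real s)"
proof -
  have l: "continuous_on {0<..<1} l" "l ` {0<..<1} \<subseteq> U" "\<And>t. t \<in> {0<..<1} \<Longrightarrow> p (l t) = of_real t"
    using assms(1) unfolding unit_interval_lift_def by auto
  obtain V' where V': "open V'" "V = U \<inter> V'" using chart_openin by (auto simp: openin_open)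
  have "openin (top_of_set {0<..<1}) ({0<..<1} \<inter> l -` V')"
    using continuous_openin_preimage_gen[OF l(1) V'(1)] .
  then have "open ({0<..<1} \<inter> l -` V')" by (simp add: openin_open_eq)
  moreover have "t \<in> {0<..<1} \<inter> l -` V'" using assms V' by auto
  ultimately obtain \<delta> where \<delta>: "\<delta> > 0" "\<And>s. dist s t < \<delta> \<Longrightarrow> s \<in> {0<..<1} \<inter> l -` V'"
    unfolding open_dist by metis
  show thesis
  proof (rule that[OF \<delta>(1)])
    fix s assume "\<bar>s - t\<bar> < \<delta>"
    then have s: "s \<in> {0<..<1}" "l s \<in> V'" using \<delta>(2)[of s] by (auto simp: dist_real_def)
    then have "l s \<in> V" using l(2) V'(2) by blast
    then show "0 < s \<and> s < 1 \<and> of_real s \<in> ball c r \<and> l s = q (of_real s)"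
      using chart_p[of "l s"] l(3)[OF s(1)] s(1) by auto
  qed
qed

end

lemma holomorphic_on_coveringI:
  assumes "\<And>V c r q. chart V c r q \<Longrightarrow> (f \<circ> q) holomorphic_on ball c r"
  shows "holomorphic_on_covering U p f"
  unfolding holomorphic_on_covering_def
proof
  fix u assume "u \<in> U"
  then obtain V r q where ch: "u \<in> V" "chart V (p u) r q" using chart_at[of u] by metis
  show "\<exists>V g. openin (top_of_set U) V \<and> u \<in> V \<and> open (p ` V) \<and> g holomorphic_on (p ` V) \<and> (\<forall>v\<in>V. f v = g (p v))"
    using ch assms[OF ch(2)] chart_image[OF ch(2)] chart_openin[OF ch(2)] chart_p[OF ch(2)]
    by (intro exI[of _ V] exI[of _ "f \<circ> q"]) auto
qed

section \<open>Identity theorems on the covering space\<close>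

text \<open>Agreement near one point of a chart spreads over the whole disc by the identity theorem
  in the plane, hence over all of \<open>U\<close> by connectedness.\<close>

lemma covering_identity_theorem_open:
  assumes f: "holomorphic_on_covering U p f" and g: "holomorphic_on_covering U p g"
    and N: "openin (top_of_set U) N" "u0 \<in> N" "\<And>v. v \<in> N \<Longrightarrow> f v = g v" and u: "u \<in> U"
  shows "f u = g u"
proof -
  define P where "P u \<longleftrightarrow> (\<exists>N. openin (top_of_set U) N \<and> u \<in> N \<and> (\<forall>v\<in>N. f v = g v))" for u
  have "P u"
  proof (rule connected_induction_simple[OF connected_U, where a = u0 and b = u and P = P])
    show "u0 \<in> U" "u \<in> U" "P u0" using N u openin_imp_subset unfolding P_def by blast+
  next
    fix a assume "a \<in> U"
    then obtain V r q where ch: "a \<in> V" "chart V (p a) r q" using chart_at[of a] by metis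
    note chf = chart_q[OF ch(2)] chart_p[OF ch(2)]
    have "P w" if v: "v \<in> V" "P v" and w: "w \<in> V" for v w
    proof -
      obtain N where N: "openin (top_of_set U) N" "v \<in> N" "\<And>v. v \<in> N \<Longrightarrow> f v = g v"
        using v(2) unfolding P_def by blast
      have "(f \<circ> q) x = (g \<circ> q) x" if "x \<in> ball (p a) r" for x
      proof (rule analytic_continuation_open[OF chart_vimage_open[OF ch(2) N(1)] open_ball _ _ _
            holomorphic_chart[OF ch(2) f] holomorphic_chart[OF ch(2) g] _ that])
        show "{x \<in> ball (p a) r. q x \<in> N} \<noteq> {}" using chf(2)[OF v(1)] N(2) by auto
      qed (auto simp: N(3))
      then have "\<forall>w\<in>V. f w = g w" using chf(2) by (metis comp_apply)
      then show ?thesis using w chart_openin[OF ch(2)] unfolding P_def by blast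
    qed
    then show "\<exists>T. openin (top_of_set U) T \<and> a \<in> T \<and> (\<forall>x\<in>T. \<forall>y\<in>T. P x \<longrightarrow> P y)"
      using ch chart_openin[OF ch(2)] by blast
  qed
  then show ?thesis unfolding P_def by blast
qed

text \<open>In a chart at \<open>l (1/2)\<close> the functions agree on a real segment, which
  accumulates at \<open>1/2\<close>; so they agree on an open sheet. This makes a continuation
  unique on \<open>U\<close> once it is fixed on the lift.\<close>

lemma covering_identity_theorem_lift:
  assumes l: "unit_interval_lift U p l"
    and f: "holomorphic_on_covering U p f" and g: "holomorphic_on_covering U p g"
    and eq: "\<And>t. 0 < t \<Longrightarrow> t < 1 \<Longrightarrow> f (l t) = g (l t)" and u: "u \<in> U"
  shows "f u = g u"
proof -
  have "l (1/2) \<in> U" using l unfolding unit_interval_lift_def by force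
  then obtain V r q where ch: "l (1/2) \<in> V" "chart V (p (l (1/2))) r q"
    using chart_at[of "l (1/2)"] by metis
  let ?c = "p (l (1/2))"
  obtain \<delta> where \<delta>: "\<delta> > 0"
    "\<And>s. \<bar>s - 1/2\<bar> < \<delta> \<Longrightarrow> 0 < s \<and> s < 1 \<and> of_real s \<in> ball ?c r \<and> l s = q (of_real s)"
    using lift_in_chart[OF ch(2) l, of "1/2"] ch(1) by auto
  define A where "A = complex_of_real ` {s. \<bar>s - 1/2\<bar> < \<delta>}"
  have lim: "of_real (1/2) islimpt A"
    unfolding islimpt_approachable
  proof (intro allI impI)
    fix e :: real assume "e > 0"
    define s where "s = 1/2 + min \<delta> e / 2"
    have "\<bar>s - 1/2\<bar> < \<delta>" "s \<noteq> 1/2" "\<bar>s - 1/2\<bar> < e" using \<open>e > 0\<close> \<delta>(1) by (auto simp: s_def)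
    then show "\<exists>x'\<in>A. x' \<noteq> of_real (1/2) \<and> dist x' (of_real (1/2)) < e"
      unfolding A_def dist_of_real by (intro bexI[of _ "of_real s"]) (auto simp: dist_of_real dist_real_def simp del: of_real_divide)
  qed
  have "(\<lambda>x. (f \<circ> q) x - (g \<circ> q) x) holomorphic_on ball ?c r"
    by (intro holomorphic_on_diff holomorphic_chart[OF ch(2)] f g)
  then have fg: "(f \<circ> q) x - (g \<circ> q) x = 0" if "x \<in> ball ?c r" for x
  proof (rule analytic_continuation[OF _ open_ball connected_ball _ _ lim _ that])
    show "A \<subseteq> ball ?c r" using \<delta>(2) unfolding A_def by blast
    have "\<bar>1/2 - 1/2\<bar> < \<delta>" using \<delta>(1) by simp
    then show "of_real (1/2) \<in> ball ?c r" using \<delta>(2) by blast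
    show "(f \<circ> q) z - (g \<circ> q) z = 0" if z: "z \<in> A" for z
    proof -
      obtain s where "z = of_real s" "\<bar>s - 1/2\<bar> < \<delta>" using z unfolding A_def by blast
      then have "l s = q z" "f (l s) = g (l s)" using \<delta>(2)[of s] eq[of s] by blast+
      then show ?thesis by simp
    qed
  qed
  show ?thesis
  proof (rule covering_identity_theorem_open[OF f g chart_openin[OF ch(2)] ch(1) _ u])
    fix v assume "v \<in> V"
    then show "f v = g v" using fg[of "p v"] chart_p[OF ch(2)] by auto
  qed
qed

section \<open>Primitives on the covering and continuation by integration\<close>

text \<open>The equation \<open>dF = h R(z) dz\<close> on \<open>U\<close>, with \<open>R\<close> a
  function of the base coordinate \<open>z = p\<close>. Asking it in all charts leaves the choice of
  chart to each application.\<close>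

definition covering_primitive :: "('u \<Rightarrow> complex) \<Rightarrow> ('u \<Rightarrow> complex) \<Rightarrow> (complex \<Rightarrow> complex) \<Rightarrow> bool" where
  "covering_primitive F h R \<longleftrightarrow> (\<forall>V c r q. chart V c r q \<longrightarrow>
     (\<forall>x\<in>ball c r. ((F \<circ> q) has_field_derivative h (q x) * R x) (at x)))"

lemma covering_primitive_holomorphic:
  "covering_primitive F h R \<Longrightarrow> holomorphic_on_covering U p F"
  by (rule holomorphic_on_coveringI) (force simp: covering_primitive_def holomorphic_on_open)

text \<open>Primitives \<open>H u\<close> exist on the disc of each chart. Their increments form an
  additive cocycle, since two local primitives differ by a constant near a common point of their
  sheets; simple connectedness then gives a global primitive.\<close>

theorem covering_primitive_exists:
  assumes h: "holomorphic_on_covering U p h" and R: "R holomorphic_on S"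
  shows "\<exists>F. covering_primitive F h R"
proof -
  have "\<exists>V r q H. u \<in> V \<and> chart V (p u) r q \<and>
      (\<forall>x\<in>ball (p u) r. (H has_field_derivative h (q x) * R x) (at x))" if u: "u \<in> U" for u
  proof -
    obtain V r q where ch: "u \<in> V" "chart V (p u) r q" using chart_at[OF u] by metis
    have "(\<lambda>x. (h \<circ> q) x * R x) holomorphic_on ball (p u) r"
      by (intro holomorphic_on_mult holomorphic_chart[OF ch(2)] h holomorphic_on_subset[OF R] chart_ball[OF ch(2)])
    then obtain H where "\<And>x. x \<in> ball (p u) r \<Longrightarrow> (H has_field_derivative (h \<circ> q) x * R x) (at x within ball (p u) r)"
      using holomorphic_convex_primitive'[OF convex_ball open_ball] by blast
    then have "\<forall>x\<in>ball (p u) r. (H has_field_derivative h (q x) * R x) (at x)"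
      by (metis at_within_open comp_apply open_ball)
    with ch show ?thesis by blast
  qed
  then obtain V r q H where VH: "\<And>u. u \<in> U \<Longrightarrow> u \<in> V u" "\<And>u. u \<in> U \<Longrightarrow> chart (V u) (p u) (r u) (q u)"
    "\<And>u x. u \<in> U \<Longrightarrow> x \<in> ball (p u) (r u) \<Longrightarrow> (H u has_field_derivative h (q u x) * R x) (at x)"
    by metis
  define d where "d u v = H u (p v) - H u (p u)" for u v
  have "additive_cocycle U d"
  proof
    fix u assume u: "u \<in> U"
    note chu = VH(2)[OF u]
    have "\<exists>M. openin (top_of_set U) M \<and> v \<in> M \<and> (\<forall>w\<in>M. d u w - d u v = d v w)" if v: "v \<in> V u" for v
    proof -
      have vU: "v \<in> U" using v chart_subset[OF chu] by blast
      note chv = VH(2)[OF vU]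
      have "open {x \<in> ball (p u) (r u). q u x \<in> V v}"
        by (rule chart_vimage_open[OF chu chart_openin[OF chv]])
      moreover have "p v \<in> {x \<in> ball (p u) (r u). q u x \<in> V v}"
        using chart_p[OF chu v] VH(1)[OF vU] by simp
      ultimately obtain e where e: "e > 0" "ball (p v) e \<subseteq> {x \<in> ball (p u) (r u). q u x \<in> V v}"
        using openE by blast
      \<comment> \<open>On this disc the charts at \<open>u\<close> and at \<open>v\<close> have the
        same local inverse, so \<open>H u\<close> and \<open>H v\<close> have the same
        derivative.\<close>
      have "((\<lambda>x. H u x - H v x) has_field_derivative 0) (at x within ball (p v) e)"
        if x: "x \<in> ball (p v) e" for x
      proof -
        have x': "x \<in> ball (p u) (r u)" "q u x \<in> V v" using e(2) x by auto
        then have "q v x = q u x" "x \<in> ball (p v) (r v)"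
          using chart_p[OF chv x'(2)] chart_q[OF chu x'(1)] by auto
        then show ?thesis
          using DERIV_diff[OF VH(3)[OF u x'(1)] VH(3)[OF vU, of x]]
          by (auto intro: has_field_derivative_at_within)
      qed
      then obtain C where C: "\<And>x. x \<in> ball (p v) e \<Longrightarrow> H u x - H v x = C"
        using has_field_derivative_zero_constant[OF convex_ball, of "p v" e "\<lambda>x. H u x - H v x"] by blast
      \<comment> \<open>\<open>d u\<close> and \<open>d v\<close> see their second argument only
        through \<open>p\<close>, so the full preimage of the disc can be taken, including other
        sheets.\<close>
      have "openin (top_of_set U) (U \<inter> p -` ball (p v) e)"
        by (intro continuous_openin_preimage_gen continuous_p open_ball)
      moreover have "\<forall>w\<in>U \<inter> p -` ball (p v) e. d u w - d u v = d v w"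
      proof
        fix w assume "w \<in> U \<inter> p -` ball (p v) e"
        then have "H u (p w) - H v (p w) = H u (p v) - H v (p v)" using C[of "p w"] C[of "p v"] e(1) by simp
        then show "d u w - d u v = d v w" unfolding d_def by (simp add: algebra_simps)
      qed
      moreover have "v \<in> U \<inter> p -` ball (p v) e" using vU e(1) by simp
      ultimately show ?thesis by blast
    qed
    moreover have "path_connected (V u)"
      using path_connected_continuous_image[OF chart_continuous_q[OF chu]] chart_image[OF chu]
      by (metis convex_ball convex_imp_path_connected)
    ultimately show "\<exists>N. openin (top_of_set U) N \<and> u \<in> N \<and> path_connected N \<and>
      (\<forall>v\<in>N. \<exists>M. openin (top_of_set U) M \<and> v \<in> M \<and> (\<forall>w\<in>M. d u w - d u v = d v w))"
      using chart_openin[OF chu] VH(1)[OF u] by blast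
  qed
  then obtain F where F: "\<And>u. u \<in> U \<Longrightarrow> \<exists>N. openin (top_of_set U) N \<and> u \<in> N \<and> (\<forall>v\<in>N. F v - F u = d u v)"
    using additive_cocycle.global_potential[OF _ simply_connected_U, of d] by auto
  have "((F \<circ> q') has_field_derivative h (q' x) * R x) (at x)"
    if ch: "chart V' c r' q'" and x: "x \<in> ball c r'" for V' c r' q' x
  proof -
    define u where "u = q' x"
    have u: "u \<in> U" "p u = x" using chart_q[OF ch x] chart_subset[OF ch] by (auto simp: u_def)
    obtain N where N: "openin (top_of_set U) N" "u \<in> N" "\<And>v. v \<in> N \<Longrightarrow> F v - F u = d u v"
      using F[OF u(1)] by blast
    have "q u x = u" "x \<in> ball (p u) (r u)" using chart_p[OF VH(2)[OF u(1)] VH(1)[OF u(1)]] u(2) by auto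
    then have "(H u has_field_derivative h u * R x) (at x)" using VH(3)[OF u(1), of x] by simp
    then have "((\<lambda>y. F u + (H u y - H u x)) has_field_derivative h u * R x) (at x)"
      by (auto intro!: derivative_eq_intros)
    then show ?thesis unfolding u_def[symmetric]
    proof (rule has_field_derivative_transform_within_open[OF _ chart_vimage_open[OF ch N(1)]])
      show "x \<in> {x \<in> ball c r'. q' x \<in> N}" using x N(2) by (simp add: u_def)
    next
      fix y assume y: "y \<in> {x \<in> ball c r'. q' x \<in> N}"
      then have "F (q' y) - F u = H u (p (q' y)) - H u (p u)" using N(3)[of "q' y"] by (simp add: d_def)
      moreover have "p (q' y) = y" using chart_q[OF ch, of y] y by simp
      ultimately show "F u + (H u y - H u x) = (F \<circ> q') y" using u(2) by (simp add: algebra_simps)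
    qed
  qed
  then show ?thesis unfolding covering_primitive_def by blast
qed

lemma covering_primitive_lift_derivative:
  assumes F: "covering_primitive F h R" and l: "unit_interval_lift U p l" and t: "0 < t" "t < 1"
  shows "((\<lambda>s. F (l s)) has_vector_derivative h (l t) * R (of_real t)) (at t)"
proof -
  have "l t \<in> U" using l t unfolding unit_interval_lift_def by force
  then obtain V r q where ch: "l t \<in> V" "chart V (p (l t)) r q" using chart_at[of "l t"] by metis
  obtain \<delta> where \<delta>: "\<delta> > 0"
    "\<And>s. \<bar>s - t\<bar> < \<delta> \<Longrightarrow> 0 < s \<and> s < 1 \<and> of_real s \<in> ball (p (l t)) r \<and> l s = q (of_real s)"
    using lift_in_chart[OF ch(2) l t ch(1)] by metis
  have "((F \<circ> q) has_field_derivative h (l t) * R (of_real t)) (at (of_real t))"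
    using F ch(2) \<delta>(1) \<delta>(2)[of t] unfolding covering_primitive_def by auto
  then have "((\<lambda>s. (F \<circ> q) (of_real s)) has_vector_derivative h (l t) * R (of_real t)) (at t)"
    by (rule has_vector_derivative_real_field)
  then show ?thesis
    by (rule has_vector_derivative_transform_within_open[where S = "ball t \<delta>"])
      (use \<delta> in \<open>auto simp: dist_real_def abs_minus_commute\<close>)
qed

text \<open>The primitive and \<open>f1\<close> have the same derivative along the lift, so they
  differ there by a constant, which is subtracted. One known continuation thus produces the
  next.\<close>

theorem continuation_primitive:
  assumes l: "unit_interval_lift U p l" and h: "is_continuation U p l f h" and R: "R holomorphic_on S"
    and f1: "\<And>t. 0 < t \<Longrightarrow> t < 1 \<Longrightarrow>
      (f1 has_field_derivative f (of_real t) * R (of_real t)) (at (of_real t))"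
  shows "\<exists>F. is_continuation U p l f1 F \<and> covering_primitive F h R"
proof -
  obtain F where F: "covering_primitive F h R"
    using covering_primitive_exists[OF _ R] h unfolding is_continuation_def by blast
  have "((\<lambda>s. F (l s) - f1 (of_real s)) has_vector_derivative 0) (at t within {0<..<1})"
    if t: "t \<in> {0<..<1}" for t
  proof -
    have "h (l t) = f (of_real t)" using h t unfolding is_continuation_def by blast
    then show ?thesis
      using has_vector_derivative_diff[OF covering_primitive_lift_derivative[OF F l, of t]
          has_vector_derivative_real_field[OF f1[of t], where s = UNIV]] t
      by (auto intro: has_vector_derivative_at_within)
  qed
  then obtain C where C: "\<And>t. t \<in> {0<..<1} \<Longrightarrow> F (l t) - f1 (of_real t) = C"
    using has_vector_derivative_zero_constant[of "{0<..<1}" "\<lambda>s. F (l s) - f1 (of_real s)"] by auto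
  define G where "G u = F u - C" for u
  have "covering_primitive G h R"
    using F unfolding covering_primitive_def G_def comp_def
    by (auto intro!: derivative_eq_intros)
  moreover from this have "is_continuation U p l f1 G"
    unfolding is_continuation_def using covering_primitive_holomorphic C
    by (auto simp: G_def algebra_simps)
  ultimately show ?thesis by blast
qed

text \<open>One witness settles the arbitrary choice in \<open>continuation\<close>: any two
  continuations agree on the lift, hence on \<open>U\<close>.\<close>

lemma continuation_eqI:
  assumes l: "unit_interval_lift U p l" and g: "is_continuation U p l f g"
  shows "is_continuation U p l f (continuation U p l f)"
    and "u \<in> U \<Longrightarrow> continuation U p l f u = g u"
proof -
  show 1: "is_continuation U p l f (continuation U p l f)"
    unfolding continuation_def by (rule someI[of "is_continuation U p l f", OF g])
  show "continuation U p l f u = g u" if "u \<in> U"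
    by (rule covering_identity_theorem_lift[OF l _ _ _ that])
      (use 1 g in \<open>auto simp: is_continuation_def\<close>)
qed

text \<open>\<open>is_continuation\<close> reads \<open>f\<close> only on the interval, so both
  choices are made from the same candidates and coincide even outside \<open>U\<close>.\<close>

lemma continuation_cong:
  assumes "\<And>t. 0 < t \<Longrightarrow> t < 1 \<Longrightarrow> f (of_real t) = f' (of_real t)"
  shows "continuation U p l f = continuation U p l f'"
  unfolding continuation_def is_continuation_def using assms by simp

lemma covering_primitive_cong:
  assumes "covering_primitive F h R" "\<And>u. u \<in> U \<Longrightarrow> F u = F' u" "\<And>u. u \<in> U \<Longrightarrow> h u = h' u"
  shows "covering_primitive F' h' R"
  unfolding covering_primitive_def
proof (intro allI impI ballI)
  fix V c r q x assume ch: "chart V c r q" and x: "x \<in> ball c r"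
  have q: "q y \<in> U" if "y \<in> ball c r" for y
    using chart_q[OF ch that] chart_subset[OF ch] by auto
  have "((F \<circ> q) has_field_derivative h (q x) * R x) (at x)"
    using assms(1) ch x unfolding covering_primitive_def by blast
  then have "((F' \<circ> q) has_field_derivative h (q x) * R x) (at x)"
    by (rule has_field_derivative_transform_within_open[OF _ open_ball x]) (use assms(2) q in auto)
  then show "((F' \<circ> q) has_field_derivative h' (q x) * R x) (at x)"
    using assms(3) q[OF x] by simp
qed

end

subsection \<open>Coefficients of multiple polylogarithms\<close>

lemma has_sum_mult_Times:
  fixes f :: "'a \<Rightarrow> 'c::{real_normed_field,banach}" and g :: "'b \<Rightarrow> 'c"
  assumes f: "(f has_sum a) A" "(\<lambda>x. norm (f x)) summable_on A"
    and g: "(g has_sum b) B" "(\<lambda>y. norm (g y)) summable_on B"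
  shows "((\<lambda>(x, y). f x * g y) has_sum (a * b)) (A \<times> B)"
    and "(\<lambda>(x, y). norm (f x * g y)) summable_on (A \<times> B)"
proof -
  have "(\<lambda>z. norm (case z of (x, y) \<Rightarrow> f x * g y)) summable_on (A \<times> B)"
    unfolding Infinite_Sum.abs_summable_on_Sigma_iff
    using f(2) g(2)
    by (auto simp: norm_mult infsum_cmult_right' abs_mult infsum_nonneg
        intro!: summable_on_cmult_right summable_on_cmult_left)
  then show "(\<lambda>(x, y). norm (f x * g y)) summable_on (A \<times> B)"
    by (simp add: case_prod_unfold)
  show "((\<lambda>(x, y). f x * g y) has_sum (a * b)) (A \<times> B)"
  proof (rule has_sum_SigmaI)
    show "((\<lambda>y. case (x, y) of (x, y) \<Rightarrow> f x * g y) has_sum f x * b) B" for x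
      using has_sum_cmult_right[OF g(1)] by simp
    show "((\<lambda>x. f x * b) has_sum a * b) A" by (rule has_sum_cmult_left[OF f(1)])
    show "(\<lambda>(x, y). f x * g y) summable_on A \<times> B"
      by (rule abs_summable_summable) fact
  qed
qed

section \<open>Power series of multiple polylogarithms and their derivatives\<close>

text \<open>The nested sum with largest summation variable fixed to \<open>m\<close>. The empty word
  is the constant series \<open>1\<close>, concentrated at \<open>m = 0\<close>, so that its partial
  sums over \<open>j < m\<close> are \<open>1\<close> for \<open>m \<ge> 1\<close>.\<close>

fun polylog_coeff :: "nat list \<Rightarrow> nat \<Rightarrow> real" where
  "polylog_coeff [] m = (if m = 0 then 1 else 0)"
| "polylog_coeff (k # ks) m = (if m = 0 then 0 else (\<Sum>j<m. polylog_coeff ks j) / real m ^ k)"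

text \<open>The series ordered by powers of \<open>z\<close>. It gives the empty word the value
  \<open>1\<close>, from which the continuation starts; in \<open>mpolylog_series\<close> the empty
  tuple would have no first entry.\<close>

definition mpolylog :: "nat list \<Rightarrow> complex \<Rightarrow> complex" where
  "mpolylog ks z = (\<Sum>m. of_real (polylog_coeff ks m) * z ^ m)"

definition positive_words :: "nat list set" where
  "positive_words = {ks. \<forall>k\<in>set ks. 1 \<le> k}"

lemma positive_words_simps [simp]:
  "[] \<in> positive_words" "k # ks \<in> positive_words \<longleftrightarrow> 1 \<le> k \<and> ks \<in> positive_words"
  by (auto simp: positive_words_def)

text \<open>Every word is built by prepending \<open>1\<close> or raising the first entry, the two ways in which
  a multiple polylogarithm is a primitive of another one.\<close>
lemma positive_words_induct [consumes 1, case_names Nil One Suc]: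
  assumes "ks \<in> positive_words" and "P []"
    and one: "\<And>ks. ks \<in> positive_words \<Longrightarrow> P ks \<Longrightarrow> P (1 # ks)"
    and suc: "\<And>k ks. k # ks \<in> positive_words \<Longrightarrow> P (k # ks) \<Longrightarrow> P (Suc k # ks)"
  shows "P ks"
  using assms(1)
proof (induction ks)
  case (Cons k ks)
  then have ks: "ks \<in> positive_words" "P ks" "1 \<le> k" by simp_all
  from \<open>1 \<le> k\<close> show ?case
  proof (induction k rule: dec_induct)
    case base
    then show ?case using one ks by simp
  next
    case (step n)
    then show ?case using suc ks by simp
  qed
qed (rule assms(2))

lemma polylog_coeff_nonneg: "0 \<le> polylog_coeff ks m"
  by (induction ks arbitrary: m) (auto intro!: sum_nonneg divide_nonneg_nonneg)

text \<open>A sum of \<open>m\<close> coefficients, each at most \<open>1\<close>, is divided by at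
  least \<open>m\<close>. The bound is the same for all words, which later yields a common bound at
  one point.\<close>

lemma polylog_coeff_le_1: "ks \<in> positive_words \<Longrightarrow> polylog_coeff ks m \<le> 1"
proof (induction ks arbitrary: m)
  case (Cons k ks)
  show ?case
  proof (cases "m = 0")
    case False
    have "(\<Sum>j<m. polylog_coeff ks j) \<le> (\<Sum>j<m. 1)" by (intro sum_mono) (use Cons in auto)
    also have "\<dots> = real m ^ 1" by simp
    also have "\<dots> \<le> real m ^ k" using Cons.prems False by (intro power_increasing) auto
    finally show ?thesis using False by simp
  qed simp
qed simp

lemma norm_polylog_term_le:
  fixes z :: complex
  assumes "ks \<in> positive_words"
  shows "norm (of_real (polylog_coeff ks m) * z ^ m) \<le> norm z ^ m"
  using polylog_coeff_le_1[OF assms, of m] polylog_coeff_nonneg[of ks m]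
  by (simp add: norm_mult norm_power mult_left_le_one_le)

lemma mpolylog_summable:
  assumes "ks \<in> positive_words" "norm z < 1"
  shows "summable (\<lambda>m. norm (of_real (polylog_coeff ks m) * z ^ m :: complex))"
    and "summable (\<lambda>m. of_real (polylog_coeff ks m) * z ^ m :: complex)"
proof -
  show "summable (\<lambda>m. norm (of_real (polylog_coeff ks m) * z ^ m :: complex))"
  proof (rule summable_comparison_test')
    show "summable (\<lambda>m. norm z ^ m)" using assms(2) by (intro summable_geometric) simp
    show "norm (norm (of_real (polylog_coeff ks m) * z ^ m :: complex)) \<le> norm z ^ m" for m
      using norm_polylog_term_le[OF assms(1)] by simp
  qed
  then show "summable (\<lambda>m. of_real (polylog_coeff ks m) * z ^ m :: complex)"
    by (rule summable_norm_cancel)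
qed

lemma norm_mpolylog_le:
  assumes "ks \<in> positive_words" "norm z < 1"
  shows "norm (mpolylog ks z) \<le> 1 / (1 - norm z)"
proof -
  have "norm (mpolylog ks z) \<le> (\<Sum>m. norm (of_real (polylog_coeff ks m) * z ^ m))"
    unfolding mpolylog_def by (rule summable_norm[OF mpolylog_summable(1)[OF assms]])
  also have "\<dots> \<le> (\<Sum>m. norm z ^ m)"
    by (intro suminf_le mpolylog_summable assms norm_polylog_term_le summable_geometric) (use assms in simp)
  also have "\<dots> = 1 / (1 - norm z)" using assms(2) by (intro suminf_geometric) simp
  finally show ?thesis .
qed

lemma mpolylog_Nil: "mpolylog [] z = 1"
proof -
  have "(\<lambda>m. of_real (polylog_coeff [] m) * z ^ m) = (\<lambda>m. if m = 0 then 1 else 0)" by auto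
  then show ?thesis using suminf_finite[of "{0::nat}" "\<lambda>m. if m = 0 then 1 else (0::complex)"]
    by (simp add: mpolylog_def)
qed

lemma mpolylog_has_derivative:
  assumes "ks \<in> positive_words" "norm z < 1"
  shows "(mpolylog ks has_field_derivative
     (\<Sum>m. of_real (real (Suc m) * polylog_coeff ks (Suc m)) * z ^ m)) (at z)"
proof -
  have "((\<lambda>z. \<Sum>m. of_real (polylog_coeff ks m) * z ^ m) has_field_derivative
      (\<Sum>m. diffs (\<lambda>m. of_real (polylog_coeff ks m)) m * z ^ m)) (at z)"
    by (rule termdiffs_strong'[where K = 1]) (use mpolylog_summable assms in auto)
  then show ?thesis by (simp add: mpolylog_def[abs_def] diffs_def)
qed

lemma polylog_coeff_Suc_Cons:
  "real (Suc m) * polylog_coeff (Suc k # ks) (Suc m) = polylog_coeff (k # ks) (Suc m)"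
  by (simp del: sum.lessThan_Suc of_nat_Suc)

text \<open>Multiplying the coefficient by \<open>m\<close> lowers the first exponent by one. A
  nonempty word has no constant term, so division by \<open>z\<close> merely shifts the
  series.\<close>

lemma mpolylog_derivative_Suc:
  assumes "k # ks \<in> positive_words" "norm z < 1" "z \<noteq> 0"
  shows "(mpolylog (Suc k # ks) has_field_derivative mpolylog (k # ks) z * (1 / z)) (at z)"
proof -
  have "mpolylog (k # ks) z = (\<Sum>m. of_real (polylog_coeff (k # ks) (Suc m)) * z ^ Suc m)"
    unfolding mpolylog_def
    using suminf_split_head[OF mpolylog_summable(2)[OF assms(1,2)]] by simp
  also have "\<dots> = (\<Sum>m. of_real (polylog_coeff (k # ks) (Suc m)) * z ^ m * z)"
    by (intro suminf_cong) simp
  also have "\<dots> = (\<Sum>m. of_real (polylog_coeff (k # ks) (Suc m)) * z ^ m) * z"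
  proof -
    have "summable (\<lambda>m. of_real (polylog_coeff (k # ks) (Suc m)) * z ^ Suc m * inverse z)"
      by (intro summable_mult2 iffD2[OF summable_Suc_iff] mpolylog_summable(2) assms)
    moreover have "(\<lambda>m. of_real (polylog_coeff (k # ks) (Suc m)) * z ^ Suc m * inverse z)
       = (\<lambda>m. of_real (polylog_coeff (k # ks) (Suc m)) * z ^ m)"
      using assms(3) by auto
    ultimately show ?thesis by (simp only: suminf_mult2)
  qed
  finally have "mpolylog (k # ks) z * (1 / z) = (\<Sum>m. of_real (polylog_coeff (k # ks) (Suc m)) * z ^ m)"
    using assms(3) by simp
  then show ?thesis
    using mpolylog_has_derivative[of "Suc k # ks" z] assms unfolding polylog_coeff_Suc_Cons by simp
qed

text \<open>The Cauchy product with the geometric series forms partial sums of coefficients, which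
  are the numerators in the recursion for \<open>1 # ks\<close>.\<close>

lemma mpolylog_derivative_One:
  assumes "ks \<in> positive_words" "norm z < 1"
  shows "(mpolylog (1 # ks) has_field_derivative mpolylog ks z * (1 / (1 - z))) (at z)"
proof -
  have "mpolylog ks z * (1 / (1 - z)) = (\<Sum>m. of_real (polylog_coeff ks m) * z ^ m) * (\<Sum>m. z ^ m)"
    using assms(2) by (simp add: mpolylog_def suminf_geometric)
  also have "\<dots> = (\<Sum>m. \<Sum>i\<le>m. of_real (polylog_coeff ks i) * z ^ i * z ^ (m - i))"
    by (rule Cauchy_product) (use mpolylog_summable(1) assms in \<open>auto simp: norm_power\<close>)
  also have "\<dots> = (\<Sum>m. of_real (real (Suc m) * polylog_coeff (1 # ks) (Suc m)) * z ^ m)"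
  proof (intro suminf_cong)
    fix m
    have "(\<Sum>i\<le>m. of_real (polylog_coeff ks i) * z ^ i * z ^ (m - i)) = (\<Sum>i\<le>m. of_real (polylog_coeff ks i) * z ^ m)"
      by (intro sum.cong) (auto simp: mult.assoc simp flip: power_add)
    then show "(\<Sum>i\<le>m. of_real (polylog_coeff ks i) * z ^ i * z ^ (m - i)) =
      of_real (real (Suc m) * polylog_coeff (1 # ks) (Suc m)) * z ^ m"
      by (simp add: sum_distrib_right lessThan_Suc_atMost)
  qed
  finally show ?thesis
    using mpolylog_has_derivative[of "1 # ks" z] assms by simp
qed

section \<open>Comparison with the sum over decreasing tuples\<close>

definition decreasing_lists :: "nat \<Rightarrow> nat list set" where
  "decreasing_lists n = {ms. length ms = n \<and> sorted_wrt (>) ms \<and> (\<forall>m\<in>set ms. 0 < m)}"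

text \<open>These are the tails of tuples with first entry \<open>m\<close>; in contrast to all
  decreasing tuples they are finite in number.\<close>

definition decreasing_lists_below :: "nat \<Rightarrow> nat \<Rightarrow> nat list set" where
  "decreasing_lists_below m n = {ms \<in> decreasing_lists n. \<forall>j\<in>set ms. j < m}"

lemma finite_decreasing_lists_below: "finite (decreasing_lists_below m n)"
  by (rule finite_subset[OF _ finite_lists_length_eq[of "{..<m}" n]])
    (auto simp: decreasing_lists_below_def decreasing_lists_def)

lemma decreasing_lists_Suc:
  "decreasing_lists (Suc n) = (\<lambda>(j, ms). j # ms) ` (SIGMA j:{1..}. decreasing_lists_below j n)"
proof (intro equalityI subsetI)
  fix ms assume "ms \<in> decreasing_lists (Suc n)"
  then show "ms \<in> (\<lambda>(j, ms). j # ms) ` (SIGMA j:{1..}. decreasing_lists_below j n)"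
    by (cases ms) (auto simp: decreasing_lists_def decreasing_lists_below_def image_iff)
qed (auto simp: decreasing_lists_def decreasing_lists_below_def)

lemma decreasing_lists_below_Suc:
  "decreasing_lists_below m (Suc n) = (\<lambda>(j, ms). j # ms) ` (SIGMA j:{1..<m}. decreasing_lists_below j n)"
proof (intro equalityI subsetI)
  fix ms assume "ms \<in> decreasing_lists_below m (Suc n)"
  then show "ms \<in> (\<lambda>(j, ms). j # ms) ` (SIGMA j:{1..<m}. decreasing_lists_below j n)"
    by (cases ms) (auto simp: decreasing_lists_def decreasing_lists_below_def image_iff)
qed (auto simp: decreasing_lists_def decreasing_lists_below_def, meson less_trans)

text \<open>Splitting off the largest entry reproduces the recursion of
  \<open>polylog_coeff\<close>. For \<open>m = 0\<close> the empty tuple would still contribute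
  \<open>1\<close> while the sum over \<open>j < 0\<close> is empty; hence
  \<open>1 \<le> m\<close>.\<close>

lemma sum_decreasing_lists_below:
  assumes "1 \<le> m"
  shows "(\<Sum>ms\<in>decreasing_lists_below m (length ks). 1 / (\<Prod>i<length ks. real (ms ! i) ^ (ks ! i)))
    = (\<Sum>j<m. polylog_coeff ks j)"
  using assms
proof (induction ks arbitrary: m)
  case Nil
  have "decreasing_lists_below m 0 = {[]}"
    by (auto simp: decreasing_lists_below_def decreasing_lists_def)
  then show ?case using Nil by simp
next
  case (Cons k ks)
  have inj: "inj_on (\<lambda>(j, ms). j # ms) A" for A :: "(nat \<times> nat list) set"
    by (auto simp: inj_on_def)
  have "(\<Sum>ms\<in>decreasing_lists_below m (length (k # ks)). 1 / (\<Prod>i<length (k # ks). real (ms ! i) ^ ((k # ks) ! i)))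
    = (\<Sum>(j, ms)\<in>(SIGMA j:{1..<m}. decreasing_lists_below j (length ks)).
         1 / (real j ^ k * (\<Prod>i<length ks. real (ms ! i) ^ (ks ! i))))"
    unfolding list.size add_Suc_right add_0_right decreasing_lists_below_Suc sum.reindex[OF inj] comp_def
    by (simp add: prod.lessThan_Suc_shift case_prod_unfold del: prod.lessThan_Suc)
  also have "\<dots> = (\<Sum>j\<in>{1..<m}. \<Sum>ms\<in>decreasing_lists_below j (length ks).
         1 / (real j ^ k * (\<Prod>i<length ks. real (ms ! i) ^ (ks ! i))))"
    by (rule sum.Sigma[symmetric]) (auto simp: finite_decreasing_lists_below)
  also have "\<dots> = (\<Sum>j\<in>{1..<m}. (\<Sum>ms\<in>decreasing_lists_below j (length ks).
         1 / (\<Prod>i<length ks. real (ms ! i) ^ (ks ! i))) / real j ^ k)"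
    by (intro sum.cong refl) (simp add: sum_divide_distrib mult.commute)
  also have "\<dots> = (\<Sum>j\<in>{1..<m}. polylog_coeff (k # ks) j)"
    by (intro sum.cong refl) (simp add: Cons.IH)
  also have "\<dots> = (\<Sum>j<m. polylog_coeff (k # ks) j)"
    by (rule sum.mono_neutral_left) auto
  finally show ?case .
qed

text \<open>The tuples are grouped by their first entry \<open>j\<close>. Each group adds up to
  \<open>polylog_coeff ks j\<close> times \<open>z ^ j\<close>, also in absolute values since the
  coefficients are nonnegative, and \<open>polylog_coeff_le_1\<close> leaves a geometric
  series.\<close>

lemma mpolylog_series_eq:
  assumes "ks \<in> positive_words" "ks \<noteq> []" "norm z < 1"
  shows "mpolylog_series ks z = mpolylog ks z"
proof -
  obtain k ks' where ks: "ks = k # ks'" using assms(2) by (cases ks) auto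
  define n where "n = length ks'"
  define f where "f = (\<lambda>(j, ms). z ^ j / (of_nat j ^ k * (\<Prod>i<n. of_nat (ms ! i) ^ (ks' ! i))))"
  define A where "A = (SIGMA j:{1..}. decreasing_lists_below j n)"
  have inj: "inj_on (\<lambda>(j, ms). j # ms) A" by (auto simp: inj_on_def)
  have rec: "(\<Sum>ms\<in>decreasing_lists_below j n. 1 / (real j ^ k * (\<Prod>i<n. real (ms ! i) ^ (ks' ! i))))
    = polylog_coeff ks j" if "1 \<le> j" for j
  proof -
    have "(\<Sum>ms\<in>decreasing_lists_below j n. 1 / (real j ^ k * (\<Prod>i<n. real (ms ! i) ^ (ks' ! i))))
      = (\<Sum>ms\<in>decreasing_lists_below j n. 1 / (\<Prod>i<n. real (ms ! i) ^ (ks' ! i))) / real j ^ k"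
      by (simp add: sum_divide_distrib mult.commute)
    then show ?thesis using that sum_decreasing_lists_below[OF that, of ks'] by (simp add: ks n_def)
  qed
  have f_eq: "f (j, ms) = of_real (1 / (real j ^ k * (\<Prod>i<n. real (ms ! i) ^ (ks' ! i)))) * z ^ j" for j ms
    by (simp add: f_def)
  have norm_f: "norm (f (j, ms)) = 1 / (real j ^ k * (\<Prod>i<n. real (ms ! i) ^ (ks' ! i))) * norm z ^ j" for j ms
    unfolding f_eq norm_mult norm_power norm_of_real
    by (simp add: prod_nonneg)
  have geo: "(\<lambda>j. norm z ^ j) summable_on {1..}"
    using has_sum_geometric_from_1[of "norm z"] assms(3) by (auto simp: summable_on_def)
  have "(\<lambda>x. norm (f x)) summable_on A"
    unfolding A_def Infinite_Sum.abs_summable_on_Sigma_iff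
  proof (intro conjI ballI)
    show "(\<lambda>y. norm (f (x, y))) summable_on decreasing_lists_below x n" for x
      by (simp add: finite_decreasing_lists_below)
    have "(\<Sum>\<^sub>\<infinity>y\<in>decreasing_lists_below j n. norm (f (j, y))) = polylog_coeff ks j * norm z ^ j"
      if "1 \<le> j" for j
      unfolding infsum_finite[OF finite_decreasing_lists_below] norm_f sum_distrib_right[symmetric] rec[OF that] ..
    moreover have "polylog_coeff ks j * norm z ^ j \<le> norm z ^ j" for j
      using polylog_coeff_le_1[OF assms(1)] polylog_coeff_nonneg by (simp add: mult_left_le_one_le)
    ultimately show "(\<lambda>x. norm (\<Sum>\<^sub>\<infinity>y\<in>decreasing_lists_below x n. norm (f (x, y)))) summable_on {1..}"
      by (intro summable_on_comparison_test[OF geo]) (auto simp: polylog_coeff_nonneg)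
  qed
  then have summ: "f summable_on A" by (rule abs_summable_summable)
  have "mpolylog_series ks z = (\<Sum>\<^sub>\<infinity>ms\<in>decreasing_lists (Suc n). z ^ hd ms / (\<Prod>i<Suc n. of_nat (ms ! i) ^ (ks ! i)))"
    by (simp add: mpolylog_series_def decreasing_lists_def ks n_def)
  also have "\<dots> = (\<Sum>\<^sub>\<infinity>x\<in>A. f x)"
    unfolding decreasing_lists_Suc A_def[symmetric] infsum_reindex[OF inj]
    by (intro infsum_cong) (auto simp: f_def ks prod.lessThan_Suc_shift simp del: prod.lessThan_Suc)
  also have "\<dots> = (\<Sum>\<^sub>\<infinity>j\<in>{1..}. \<Sum>\<^sub>\<infinity>ms\<in>decreasing_lists_below j n. f (j, ms))"
    unfolding A_def by (rule infsum_Sigma_banach[symmetric]) (use summ in \<open>simp add: A_def\<close>)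
  also have "\<dots> = (\<Sum>\<^sub>\<infinity>j\<in>{1..}. of_real (polylog_coeff ks j) * z ^ j)"
  proof (intro infsum_cong)
    fix j :: nat assume "j \<in> {1..}"
    then have j: "1 \<le> j" by simp
    show "(\<Sum>\<^sub>\<infinity>ms\<in>decreasing_lists_below j n. f (j, ms)) = of_real (polylog_coeff ks j) * z ^ j"
      unfolding infsum_finite[OF finite_decreasing_lists_below] f_eq sum_distrib_right[symmetric]
        of_real_sum[symmetric] rec[OF j] ..
  qed
  also have "\<dots> = (\<Sum>\<^sub>\<infinity>j. of_real (polylog_coeff ks j) * z ^ j)"
    by (rule infsum_cong_neutral) (auto simp: ks not_le)
  also have "\<dots> = mpolylog ks z"
    unfolding mpolylog_def
    by (intro infsumI norm_summable_imp_has_sum mpolylog_summable assms summable_sums)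
  finally show ?thesis .
qed

subsection \<open>Weighted sums over indices\<close>

lemma has_sum_complex_norm_summable:
  fixes f :: "'a \<Rightarrow> complex"
  assumes "(f has_sum a) A"
  shows "(\<lambda>x. norm (f x)) summable_on A"
proof -
  have "f summable_on A" using assms by (rule has_sum_imp_summable)
  then show ?thesis by (simp add: summable_on_iff_abs_summable_on_complex)
qed

lemma has_sum_Cons_iff:
  "(f has_sum S) {k # ks |k ks. k \<in> A \<and> ks \<in> B} \<longleftrightarrow> ((\<lambda>(k, ks). f (k # ks)) has_sum S) (A \<times> B)"
proof -
  have "bij_betw (\<lambda>(k, ks). k # ks) (A \<times> B) {k # ks |k ks. k \<in> A \<and> ks \<in> B}"
    by (rule bij_betwI[where g = "\<lambda>ks. (hd ks, tl ks)"]) auto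
  from has_sum_reindex_bij_betw[OF this, of f S] show ?thesis by (simp add: case_prod_unfold)
qed

lemma positive_words_eq: "positive_words = insert [] {k # ks |k ks. k \<in> {1..} \<and> ks \<in> positive_words}"
proof (intro set_eqI)
  fix ks show "ks \<in> positive_words \<longleftrightarrow> ks \<in> insert [] {k # ks |k ks. k \<in> {1..} \<and> ks \<in> positive_words}"
    by (cases ks) auto
qed

section \<open>Weights of words and their summability\<close>

lemma summable_positive_words:
  fixes r :: real
  assumes "0 \<le> r" "r < 1/2"
  shows "(\<lambda>ks. r ^ sum_list ks) summable_on positive_words"
proof -
  \<comment> \<open>The sum of \<open>r ^ k\<close> over one entry. Words of length \<open>n\<close>
    add up to \<open>q ^ n\<close>, and \<open>q < 1\<close> means \<open>r < 1/2\<close>: this is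
    the origin of the bound \<open>1/2\<close> on the parameters.\<close>
  define q where "q = r / (1 - r)"
  have q: "0 \<le> q" "q < 1" using assms by (auto simp: q_def field_simps)
  define W where "W n = {ks \<in> positive_words. length ks = n}" for n
  have geo: "((\<lambda>k. r ^ k) has_sum q) {1..}"
    unfolding q_def by (rule has_sum_geometric_from_1) (use assms in auto)
  have norm_geo: "(\<lambda>k. norm (r ^ k)) summable_on {1..}"
    using geo assms(1) by (simp add: summable_on_def) blast
  have W_Suc: "W (Suc n) = {k # ks |k ks. k \<in> {1..} \<and> ks \<in> W n}" for n
    unfolding W_def by (auto simp: length_Suc_conv)
  have hs: "((\<lambda>ks. r ^ sum_list ks) has_sum q ^ n) (W n)" for n
  proof (induction n)
    case 0
    have "W 0 = {[]}" by (auto simp: W_def)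
    then show ?case by (simp add: has_sum_finite_iff)
  next
    case (Suc n)
    have "(\<lambda>ks. norm (r ^ sum_list ks)) summable_on W n"
      using Suc.IH assms(1) by (simp add: summable_on_def) blast
    then have "((\<lambda>(k, ks). r ^ k * r ^ sum_list ks) has_sum q * q ^ n) ({1..} \<times> W n)"
      by (rule has_sum_mult_Times(1)[OF geo norm_geo Suc.IH])
    then show ?case unfolding W_Suc has_sum_Cons_iff by (simp add: power_add)
  qed
  have "(\<lambda>x. norm (r ^ sum_list (snd x))) summable_on (SIGMA n:UNIV. W n)"
    unfolding Infinite_Sum.abs_summable_on_Sigma_iff
  proof (intro conjI ballI)
    show "(\<lambda>y. norm (r ^ sum_list (snd (n, y)))) summable_on W n" for n
      using hs[of n] assms(1) by (simp add: summable_on_def) blast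
    have "(\<Sum>\<^sub>\<infinity>y\<in>W n. norm (r ^ sum_list (snd (n, y)))) = q ^ n" for n
      using hs[of n] assms(1) by (simp add: infsumI)
    then show "(\<lambda>n. norm (\<Sum>\<^sub>\<infinity>y\<in>W n. norm (r ^ sum_list (snd (n, y))))) summable_on UNIV"
      using q by (simp add: summable_on_UNIV_nonneg_real_iff)
  qed
  then have "((\<lambda>ks. r ^ sum_list ks) \<circ> snd) summable_on (SIGMA n:UNIV. W n)"
    using assms(1) by (simp add: comp_def)
  moreover have "bij_betw snd (SIGMA n:UNIV. W n) positive_words"
    by (rule bij_betwI[where g = "\<lambda>ks. (length ks, ks)"]) (auto simp: W_def)
  ultimately show ?thesis
    using summable_on_reindex_bij_betw by (fastforce simp: comp_def)
qed

text \<open>The weight of an entry is chosen such that its generating function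
  \<open>e m = (\<Sum>k\<ge>1. entry_weight x y w k / m^k)\<close> is rational; for the parameters of the theorem
  \<open>1 + e m\<close> is the ratio of consecutive hypergeometric coefficients.\<close>
definition entry_weight :: "complex \<Rightarrow> complex \<Rightarrow> complex \<Rightarrow> nat \<Rightarrow> complex" where
  "entry_weight x y w k = (if k = 1 then y else w * x ^ (k - 2))"

definition word_weight :: "complex \<Rightarrow> complex \<Rightarrow> complex \<Rightarrow> nat list \<Rightarrow> complex" where
  "word_weight x y w ks = (\<Prod>k\<leftarrow>ks. entry_weight x y w k)"

text \<open>The first entry, which is at least \<open>2\<close>, has its factor \<open>w\<close>
  removed; this accounts for the exponent \<open>s - 1\<close> in the theorem.\<close>

fun admissible_weight :: "complex \<Rightarrow> complex \<Rightarrow> complex \<Rightarrow> nat list \<Rightarrow> complex" where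
  "admissible_weight x y w [] = 0"
| "admissible_weight x y w (k # ks) = x ^ (k - 2) * word_weight x y w ks"

definition admissible_words :: "nat list set" where
  "admissible_words = {k # ks |k ks. k \<in> {2..} \<and> ks \<in> positive_words}"

lemma admissible_words_subset: "admissible_words \<subseteq> positive_words"
  by (auto simp: admissible_words_def)

lemma word_weight_simps [simp]:
  "word_weight x y w [] = 1"
  "word_weight x y w (k # ks) = entry_weight x y w k * word_weight x y w ks"
  by (simp_all add: word_weight_def)

text \<open>\<open>y\<close> has size at most \<open>r\<close> and \<open>w * x ^ (k - 2)\<close> at
  most \<open>r ^ k\<close>, so every entry \<open>k\<close> contributes at most a factor
  \<open>r ^ k\<close>.\<close>

lemma norm_word_weight_le:
  assumes "norm x \<le> r" "norm y \<le> r" "norm w \<le> r\<^sup>2" "ks \<in> positive_words"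
  shows "norm (word_weight x y w ks) \<le> r ^ sum_list ks"
  using assms(4)
proof (induction ks)
  case (Cons k ks)
  have r: "0 \<le> r" using assms(1) norm_ge_zero order_trans by blast
  have "norm (entry_weight x y w k) \<le> r ^ k"
  proof (cases "k = 1")
    case False
    then have k: "k = 2 + (k - 2)" using Cons.prems unfolding positive_words_simps by linarith
    have "norm w * norm x ^ (k - 2) \<le> r\<^sup>2 * r ^ (k - 2)"
      by (intro mult_mono assms power_mono) (use r in auto)
    also have "\<dots> = r ^ k" by (subst (2) k) (rule power_add[symmetric])
    finally show ?thesis using False by (simp add: entry_weight_def norm_mult norm_power)
  qed (use assms in \<open>simp add: entry_weight_def\<close>)
  then show ?case
    using Cons r by (auto simp: norm_mult power_add intro!: mult_mono)
qed simp

text \<open>As for words, but the factor \<open>w\<close> missing at the first entry would have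
  contributed \<open>r\<^sup>2\<close>.\<close>

lemma norm_admissible_weight_le:
  assumes "norm x \<le> r" "norm y \<le> r" "norm w \<le> r\<^sup>2" "0 < r" "ks \<in> admissible_words"
  shows "norm (admissible_weight x y w ks) \<le> r ^ sum_list ks / r\<^sup>2"
proof -
  obtain k ks' where ks: "ks = k # ks'" "2 \<le> k" "ks' \<in> positive_words"
    using assms(5) by (auto simp: admissible_words_def)
  have "norm (admissible_weight x y w ks) \<le> r ^ (k - 2) * r ^ sum_list ks'"
    unfolding ks by (simp add: norm_mult norm_power)
      (intro mult_mono power_mono norm_word_weight_le assms ks, use assms in auto)
  also have "\<dots> = r ^ sum_list ks / r\<^sup>2"
    using assms(4) ks(2) by (simp add: ks power_add power_diff)
  finally show ?thesis .
qed

lemma has_sum_shifted_geometric: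
  fixes x c :: complex
  assumes "norm x < 1" "1 \<le> m"
  shows "((\<lambda>k. c * x ^ (k - 2) / of_nat m ^ k) has_sum c / (of_nat m * (of_nat m - x))) {2..}"
    and "(\<lambda>k. norm (c * x ^ (k - 2) / of_nat m ^ k)) summable_on {2..}"
proof -
  have m: "norm (x / of_nat m) < 1" "of_nat m \<noteq> x" "(of_nat m :: complex) \<noteq> 0"
  proof -
    have "norm x < real m" using assms by linarith
    then show "norm (x / of_nat m) < 1" "of_nat m \<noteq> x" using assms(2) by (auto simp: norm_divide)
  qed (use assms in simp)
  have "((\<lambda>k. (x / of_nat m) ^ k) has_sum 1 / (1 - x / of_nat m)) UNIV"
    by (intro norm_summable_imp_has_sum geometric_sums)
      (use m in \<open>auto simp: norm_power intro!: summable_geometric\<close>)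
  then have "((\<lambda>k. c / (of_nat m)\<^sup>2 * (x / of_nat m) ^ k) has_sum c / (of_nat m)\<^sup>2 * (1 / (1 - x / of_nat m))) UNIV"
    by (rule has_sum_cmult_right)
  moreover have "c / (of_nat m)\<^sup>2 * (x / of_nat m) ^ k = c * x ^ (k + 2 - 2) / of_nat m ^ (k + 2)" for k
    by (simp add: power_divide power_add power2_eq_square)
  moreover have "c / (of_nat m)\<^sup>2 * (1 / (1 - x / of_nat m)) = c / (of_nat m * (of_nat m - x))"
    using m by (simp add: field_simps power2_eq_square)
  ultimately have "((\<lambda>k. c * x ^ (k + 2 - 2) / of_nat m ^ (k + 2)) has_sum c / (of_nat m * (of_nat m - x))) UNIV"
    by (simp only:)
  moreover have "bij_betw (\<lambda>k. k + 2) UNIV {2::nat..}"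
    by (rule bij_betwI[where g = "\<lambda>k. k - 2"]) auto
  ultimately show *: "((\<lambda>k. c * x ^ (k - 2) / of_nat m ^ k) has_sum c / (of_nat m * (of_nat m - x))) {2..}"
    using has_sum_reindex_bij_betw[of "\<lambda>k. k + 2" UNIV "{2..}" "\<lambda>k. c * x ^ (k - 2) / of_nat m ^ k"] by simp
  then show "(\<lambda>k. norm (c * x ^ (k - 2) / of_nat m ^ k)) summable_on {2..}"
    by (rule has_sum_complex_norm_summable)
qed

lemma has_sum_entry_weight:
  assumes "norm x < 1" "1 \<le> m"
  shows "((\<lambda>k. entry_weight x y w k / of_nat m ^ k) has_sum
           (y / of_nat m + w / (of_nat m * (of_nat m - x)))) {1..}"
    and "(\<lambda>k. norm (entry_weight x y w k / of_nat m ^ k)) summable_on {1..}"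
proof -
  have "((\<lambda>k. entry_weight x y w k / of_nat m ^ k) has_sum w / (of_nat m * (of_nat m - x))) {2..}"
    using has_sum_shifted_geometric(1)[OF assms, of w]
    by (rule has_sum_cong[THEN iffD1, rotated]) (auto simp: entry_weight_def)
  moreover have "((\<lambda>k. entry_weight x y w k / of_nat m ^ k) has_sum y / of_nat m) {1}"
    by (simp add: has_sum_finite_iff entry_weight_def)
  ultimately have "((\<lambda>k. entry_weight x y w k / of_nat m ^ k) has_sum
           (y / of_nat m + w / (of_nat m * (of_nat m - x)))) ({1} \<union> {2..})"
    by (intro has_sum_Un_disjoint) auto
  moreover have "{1} \<union> {2..} = {1::nat..}" by auto
  ultimately show *: "((\<lambda>k. entry_weight x y w k / of_nat m ^ k) has_sum
           (y / of_nat m + w / (of_nat m * (of_nat m - x)))) {1..}" by simp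
  then show "(\<lambda>k. norm (entry_weight x y w k / of_nat m ^ k)) summable_on {1..}"
    by (rule has_sum_complex_norm_summable)
qed

section \<open>Generating functions and the hypergeometric coefficients\<close>

text \<open>Passing from \<open>m\<close> to \<open>m + 1\<close> adds the terms with largest
  variable \<open>m\<close>. Their first entry sums to \<open>e m\<close> independently of the tail,
  and the tails give the previous total, which is therefore multiplied by \<open>1 + e m\<close>.
  For \<open>m = 1\<close> only the empty word counts.\<close>

lemma has_sum_word_weight:
  assumes "norm x < 1" "1 \<le> m"
  shows "((\<lambda>ks. word_weight x y w ks * of_real (\<Sum>j<m. polylog_coeff ks j)) has_sum
     (\<Prod>j\<in>{1..<m}. 1 + (y / of_nat j + w / (of_nat j * (of_nat j - x))))) positive_words"
  using assms(2)
proof (induction m rule: dec_induct)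
  case base
  have "(\<Sum>j<1. polylog_coeff ks j) = (if ks = [] then 1 else 0)" for ks by (cases ks) auto
  then have "((\<lambda>ks. word_weight x y w ks * of_real (\<Sum>j<1. polylog_coeff ks j)) has_sum 1) positive_words"
    by (intro has_sum_finite_neutralI[of "{[]}"]) auto
  then show ?case by simp
next
  case (step m)
  let ?e = "y / of_nat m + w / (of_nat m * (of_nat m - x))"
  let ?S = "\<Prod>j\<in>{1..<m}. 1 + (y / of_nat j + w / (of_nat j * (of_nat j - x)))"
  have "(\<lambda>ks. norm (word_weight x y w ks * of_real (\<Sum>j<m. polylog_coeff ks j))) summable_on positive_words"
    by (rule has_sum_complex_norm_summable[OF step.IH])
  then have "((\<lambda>(k, ks). entry_weight x y w k / of_nat m ^ k * (word_weight x y w ks * of_real (\<Sum>j<m. polylog_coeff ks j)))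
      has_sum ?e * ?S) ({1..} \<times> positive_words)"
    by (rule has_sum_mult_Times(1)[OF has_sum_entry_weight[OF assms(1) step.hyps(1)] step.IH])
  moreover have "(\<lambda>(k, ks). entry_weight x y w k / of_nat m ^ k * (word_weight x y w ks * of_real (\<Sum>j<m. polylog_coeff ks j)))
     = (\<lambda>(k, ks). word_weight x y w (k # ks) * of_real (polylog_coeff (k # ks) m))"
    using step.hyps(1) by (auto simp: fun_eq_iff)
  ultimately have "((\<lambda>ks. word_weight x y w ks * of_real (polylog_coeff ks m)) has_sum ?e * ?S)
      {k # ks |k ks. k \<in> {1..} \<and> ks \<in> positive_words}"
    unfolding has_sum_Cons_iff by simp
  moreover have "((\<lambda>ks. word_weight x y w ks * of_real (polylog_coeff ks m)) has_sum 0) {[]}"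
    using step.hyps(1) by (simp add: has_sum_finite_iff)
  ultimately have "((\<lambda>ks. word_weight x y w ks * of_real (polylog_coeff ks m)) has_sum ?e * ?S + 0)
      ({k # ks |k ks. k \<in> {1..} \<and> ks \<in> positive_words} \<union> {[]})"
    by (intro has_sum_Un_disjoint) auto
  then have "((\<lambda>ks. word_weight x y w ks * of_real (polylog_coeff ks m)) has_sum ?e * ?S) positive_words"
    using positive_words_eq by simp
  then have "((\<lambda>ks. word_weight x y w ks * of_real (\<Sum>j<m. polylog_coeff ks j) +
      word_weight x y w ks * of_real (polylog_coeff ks m)) has_sum ?S + ?e * ?S) positive_words"
    by (rule has_sum_add[OF step.IH])
  moreover have "?S + ?e * ?S = (\<Prod>j\<in>{1..<Suc m}. 1 + (y / of_nat j + w / (of_nat j * (of_nat j - x))))"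
    using step.hyps(1) by (simp add: atLeastLessThanSuc algebra_simps)
  ultimately show ?case by (simp add: algebra_simps)
qed

lemma has_sum_admissible_weight:
  assumes "norm x < 1" "1 \<le> m"
  shows "((\<lambda>ks. admissible_weight x y w ks * of_real (polylog_coeff ks m)) has_sum
     (1 / (of_nat m * (of_nat m - x)) *
       (\<Prod>j\<in>{1..<m}. 1 + (y / of_nat j + w / (of_nat j * (of_nat j - x)))))) admissible_words"
proof -
  have "(\<lambda>ks. norm (word_weight x y w ks * of_real (\<Sum>j<m. polylog_coeff ks j))) summable_on positive_words"
    by (rule has_sum_complex_norm_summable[OF has_sum_word_weight[OF assms]])
  note has_sum_mult_Times(1)[OF has_sum_shifted_geometric[OF assms, of 1] has_sum_word_weight[OF assms] this]
  moreover have "(\<lambda>(k, ks). 1 * x ^ (k - 2) / of_nat m ^ k * (word_weight x y w ks * of_real (\<Sum>j<m. polylog_coeff ks j)))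
     = (\<lambda>(k, ks). admissible_weight x y w (k # ks) * of_real (polylog_coeff (k # ks) m))"
    using assms(2) by (auto simp: fun_eq_iff)
  ultimately show ?thesis
    unfolding admissible_words_def has_sum_Cons_iff by simp
qed

text \<open>The product supplies the Pochhammer factors with \<open>1 \<le> j < m\<close> and
  \<open>\<alpha> * \<beta>\<close> those with \<open>j = 0\<close>. In the denominator
  \<open>j - (1 - \<gamma>) = \<gamma> + (j - 1)\<close> is shifted by one, and the factor in front
  adds the one for \<open>j = m\<close>.\<close>

lemma pochhammer_ratio_eq_prod:
  fixes \<alpha> \<beta> \<gamma> :: complex
  assumes "norm (1 - \<gamma>) < 1" "1 \<le> m"
  shows "\<alpha> * \<beta> * (1 / (of_nat m * (of_nat m - (1 - \<gamma>))) * (\<Prod>j\<in>{1..<m}.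
      1 + ((\<alpha> + \<beta> + 1 - \<gamma>) / of_nat j + (\<alpha> + 1 - \<gamma>) * (\<beta> + 1 - \<gamma>) / (of_nat j * (of_nat j - (1 - \<gamma>))))))
    = pochhammer \<alpha> m * pochhammer \<beta> m / (pochhammer \<gamma> m * fact m)"
  using assms(2)
proof (induction m rule: dec_induct)
  case base
  then show ?case by simp
next
  case (step m)
  let ?e = "(\<alpha> + \<beta> + 1 - \<gamma>) / of_nat m + (\<alpha> + 1 - \<gamma>) * (\<beta> + 1 - \<gamma>) / (of_nat m * (of_nat m - (1 - \<gamma>)))"
  let ?P = "\<Prod>j\<in>{1..<m}. 1 + ((\<alpha> + \<beta> + 1 - \<gamma>) / of_nat j + (\<alpha> + 1 - \<gamma>) * (\<beta> + 1 - \<gamma>) / (of_nat j * (of_nat j - (1 - \<gamma>))))"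
  have nz: "of_nat j - (1 - \<gamma>) \<noteq> 0" if "1 \<le> j" for j
  proof
    assume "of_nat j - (1 - \<gamma>) = 0"
    then have "norm (1 - \<gamma>) = real j" by (metis eq_iff_diff_eq_0 norm_of_nat)
    then show False using assms(1) that by simp
  qed
  have m: "of_nat m \<noteq> (0::complex)" "of_nat m - (1 - \<gamma>) \<noteq> 0" using step.hyps(1) nz by auto
  \<comment> \<open>With \<open>x = 1 - \<gamma>\<close> and \<open>y\<close>, \<open>w\<close> for
    the other two parameters the numerator is \<open>m^2 + (y - x) m + (w - x y)\<close>, where
    \<open>y - x = \<alpha> + \<beta>\<close> and \<open>w - x y = \<alpha> \<beta>\<close>.\<close>
  have e: "1 + ?e = (\<alpha> + of_nat m) * (\<beta> + of_nat m) / (of_nat m * (of_nat m - (1 - \<gamma>)))"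
    using m by (simp add: divide_simps) (simp add: algebra_simps)
  have "\<alpha> * \<beta> * (1 / (of_nat (Suc m) * (of_nat (Suc m) - (1 - \<gamma>))) * (?P * (1 + ?e)))
    = \<alpha> * \<beta> * (1 / (of_nat m * (of_nat m - (1 - \<gamma>))) * ?P) *
        ((\<alpha> + of_nat m) * (\<beta> + of_nat m) / (of_nat (Suc m) * (of_nat (Suc m) - (1 - \<gamma>))))"
    unfolding e by (simp add: mult_ac)
  also have "\<dots> = pochhammer \<alpha> m * pochhammer \<beta> m / (pochhammer \<gamma> m * fact m) *
        ((\<alpha> + of_nat m) * (\<beta> + of_nat m) / (of_nat (Suc m) * (\<gamma> + of_nat m)))"
    unfolding step.IH by (simp add: algebra_simps)
  also have "\<dots> = pochhammer \<alpha> (Suc m) * pochhammer \<beta> (Suc m) / (pochhammer \<gamma> (Suc m) * fact (Suc m))"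
    by (simp add: pochhammer_Suc mult_ac del: of_nat_Suc)
  finally show ?case using step.hyps(1) by (simp add: atLeastLessThanSuc mult.commute del: of_nat_Suc)
qed

lemma summable_admissible_words:
  fixes r :: real
  assumes "0 \<le> r" "r < 1/2"
  shows "(\<lambda>ks. r ^ sum_list ks / r\<^sup>2) summable_on admissible_words"
  using summable_on_cmult_left[OF summable_on_subset_banach[OF summable_positive_words[OF assms]
        admissible_words_subset], of "inverse (r\<^sup>2)"]
  by (simp add: divide_inverse)

text \<open>The double series over words and powers of \<open>z\<close> is dominated by the product
  of the word majorant and a geometric series, so it may be summed over the words first. The
  coefficient of \<open>z ^ m\<close> is then the hypergeometric one.\<close>

lemma gauss_series_eq_words:
  fixes \<alpha> \<beta> \<gamma> z :: complex
  defines "x \<equiv> 1 - \<gamma>" and "y \<equiv> \<alpha> + \<beta> + 1 - \<gamma>" and "w \<equiv> (\<alpha> + 1 - \<gamma>) * (\<beta> + 1 - \<gamma>)"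
  assumes r: "0 < r" "r < 1/2" "norm x \<le> r" "norm y \<le> r" "norm w \<le> r\<^sup>2" and z: "norm z < 1"
  shows "gauss_series \<alpha> \<beta> \<gamma> z =
    1 + \<alpha> * \<beta> * (\<Sum>\<^sub>\<infinity>ks\<in>admissible_words. admissible_weight x y w ks * mpolylog ks z)"
proof -
  define f where "f ks m = admissible_weight x y w ks * of_real (polylog_coeff ks m) * z ^ m" for ks m
  define \<phi> where "\<phi> m = (\<Sum>\<^sub>\<infinity>ks\<in>admissible_words. admissible_weight x y w ks * of_real (polylog_coeff ks m))" for m
  define c where "c m = pochhammer \<alpha> m * pochhammer \<beta> m / (pochhammer \<gamma> m * fact m)" for m
  have x1: "norm x < 1" using r by linarith
  have geo: "(\<lambda>m. norm z ^ m) summable_on UNIV"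
    using z by (simp add: summable_on_UNIV_nonneg_real_iff)
  have wsum: "(\<lambda>ks. r ^ sum_list ks / r\<^sup>2) summable_on admissible_words"
    using r by (intro summable_admissible_words) auto
  have "(\<lambda>(ks, m). norm (r ^ sum_list ks / r\<^sup>2 * norm z ^ m)) summable_on admissible_words \<times> UNIV"
    by (rule has_sum_mult_Times(2)[OF has_sum_infsum[OF wsum] _ has_sum_infsum[OF geo]])
      (use r wsum geo in auto)
  then have "(\<lambda>q. norm (case q of (ks, m) \<Rightarrow> f ks m)) summable_on admissible_words \<times> UNIV"
  proof (rule summable_on_comparison_test)
    fix q assume "q \<in> admissible_words \<times> (UNIV :: nat set)"
    then obtain ks m where q: "q = (ks, m)" "ks \<in> admissible_words" by auto
    have "norm (f ks m) = norm (admissible_weight x y w ks) * norm (of_real (polylog_coeff ks m) * z ^ m)"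
      by (simp add: f_def norm_mult)
    also have "\<dots> \<le> r ^ sum_list ks / r\<^sup>2 * norm z ^ m"
      using q(2) admissible_words_subset r
      by (intro mult_mono norm_admissible_weight_le norm_polylog_term_le) auto
    also have "\<dots> \<le> norm (r ^ sum_list ks / r\<^sup>2 * norm z ^ m)" unfolding real_norm_def by (rule abs_ge_self)
    finally show "norm (case q of (ks, m) \<Rightarrow> f ks m) \<le> (case q of (ks, m) \<Rightarrow> norm (r ^ sum_list ks / r\<^sup>2 * norm z ^ m))"
      by (simp add: q)
  qed simp
  then have fsum: "(\<lambda>(ks, m). f ks m) summable_on admissible_words \<times> UNIV" by (rule abs_summable_summable)
  have "(\<Sum>\<^sub>\<infinity>ks\<in>admissible_words. admissible_weight x y w ks * mpolylog ks z)
    = (\<Sum>\<^sub>\<infinity>ks\<in>admissible_words. \<Sum>\<^sub>\<infinity>m. f ks m)"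
  proof (intro infsum_cong)
    fix ks assume "ks \<in> admissible_words"
    then have "ks \<in> positive_words" using admissible_words_subset by blast
    then have "(\<Sum>\<^sub>\<infinity>m. of_real (polylog_coeff ks m) * z ^ m) = mpolylog ks z"
      unfolding mpolylog_def
      by (intro infsumI norm_summable_imp_has_sum mpolylog_summable z summable_sums)
    then show "admissible_weight x y w ks * mpolylog ks z = (\<Sum>\<^sub>\<infinity>m. f ks m)"
      by (simp add: f_def mult.assoc infsum_cmult_right')
  qed
  also have "\<dots> = (\<Sum>\<^sub>\<infinity>m. \<Sum>\<^sub>\<infinity>ks\<in>admissible_words. f ks m)"
    by (rule infsum_swap_banach[OF fsum])
  also have "\<dots> = (\<Sum>\<^sub>\<infinity>m. \<phi> m * z ^ m)"
    by (simp add: f_def \<phi>_def infsum_cmult_left')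
  finally have eq: "(\<Sum>\<^sub>\<infinity>ks\<in>admissible_words. admissible_weight x y w ks * mpolylog ks z) = (\<Sum>\<^sub>\<infinity>m. \<phi> m * z ^ m)" .
  have "(\<lambda>(m, ks). f ks m) summable_on UNIV \<times> admissible_words"
    using fsum summable_on_swap[of "\<lambda>(ks, m). f ks m" admissible_words UNIV] by (simp add: case_prod_unfold)
  then have "(\<lambda>m. \<Sum>\<^sub>\<infinity>ks\<in>admissible_words. f ks m) summable_on UNIV"
    by (rule summable_on_Sigma_banach)
  then have "(\<lambda>m. \<phi> m * z ^ m) summable_on UNIV"
    by (simp add: f_def \<phi>_def infsum_cmult_left')
  then have hs: "(\<lambda>m. \<phi> m * z ^ m) sums (\<Sum>\<^sub>\<infinity>m. \<phi> m * z ^ m)"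
    by (intro has_sum_imp_sums has_sum_infsum)
  \<comment> \<open>Admissible words are nonempty, so they contribute nothing at
    \<open>m = 0\<close>; the constant term \<open>1\<close> of the Gauss series is added
    separately.\<close>
  have \<phi>0: "\<phi> 0 = 0"
    unfolding \<phi>_def by (rule infsum_0) (auto simp: admissible_words_def)
  have \<phi>c: "\<alpha> * \<beta> * \<phi> m = c m" if "1 \<le> m" for m
    unfolding \<phi>_def infsumI[OF has_sum_admissible_weight[OF x1 that]]
    unfolding c_def x_def y_def w_def
    by (rule pochhammer_ratio_eq_prod) (use x1 that in \<open>auto simp: x_def\<close>)
  have "(\<lambda>m. (if m = 0 then 1 else 0) + \<alpha> * \<beta> * (\<phi> m * z ^ m)) sums (1 + \<alpha> * \<beta> * (\<Sum>\<^sub>\<infinity>m. \<phi> m * z ^ m))"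
    by (intro sums_add sums_mult hs) (use sums_single[of 0 "\<lambda>_. 1::complex"] in simp)
  moreover have "(if m = 0 then 1 else 0) + \<alpha> * \<beta> * (\<phi> m * z ^ m) = c m * z ^ m" for m
    using \<phi>0 \<phi>c[of m] by (cases "m = 0") (auto simp: c_def simp flip: mult.assoc)
  ultimately have "(\<lambda>m. c m * z ^ m) sums (1 + \<alpha> * \<beta> * (\<Sum>\<^sub>\<infinity>m. \<phi> m * z ^ m))" by simp
  then show ?thesis unfolding gauss_series_def eq c_def by (rule sums_unique[symmetric])
qed

section \<open>Grouping of words by weight, depth and height\<close>

definition word_type :: "nat list \<Rightarrow> nat \<times> nat \<times> nat" where
  "word_type ks = (sum_list ks, length ks, length (filter (\<lambda>k. 2 \<le> k) ks))"

definition words_of_type :: "nat \<times> nat \<times> nat \<Rightarrow> nat list set" where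
  "words_of_type = (\<lambda>(k, n, s). admissible_indices k n s)"

lemma words_of_type_eq:
  assumes "t \<in> index_triples"
  shows "words_of_type t = {ks \<in> admissible_words. word_type ks = t}"
proof (intro set_eqI)
  fix ks
  obtain k n s where t: "t = (k, n, s)" by (cases t)
  then have n: "0 < n" using assms by (simp add: index_triples_def)
  show "ks \<in> words_of_type t \<longleftrightarrow> ks \<in> {ks \<in> admissible_words. word_type ks = t}"
  proof (cases ks)
    case Nil
    then show ?thesis using n by (auto simp: t words_of_type_def admissible_indices_def admissible_words_def)
  next
    case (Cons a as)
    then show ?thesis
      by (auto simp: t words_of_type_def admissible_indices_def admissible_words_def word_type_def
          length_filter_conv_card positive_words_def)
  qed
qed

lemma finite_words_of_type: "finite (words_of_type t)"
proof -
  obtain k n s where t: "t = (k, n, s)" by (cases t)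
  show ?thesis
    unfolding t words_of_type_def
    by (rule finite_subset[OF _ finite_lists_length_eq[of "{..k}" n]])
      (auto simp: admissible_indices_def intro: member_le_sum_list)
qed

text \<open>An entry \<open>a \<ge> 2\<close> gives \<open>w * x ^ (a - 2)\<close>, an entry
  \<open>1\<close> gives \<open>y\<close>, and the exponents \<open>a - 2\<close> add up to
  \<open>k - 2 s - (n - s)\<close>. The inequalities belong to the induction because subtraction is
  truncated.\<close>

lemma word_weight_eq:
  assumes "ks \<in> positive_words" "word_type ks = (k, n, s)"
  shows "s \<le> n \<and> n + s \<le> k \<and> word_weight x y w ks = x ^ (k - n - s) * y ^ (n - s) * w ^ s"
  using assms
proof (induction ks arbitrary: k n s)
  case (Cons a ks)
  obtain k' n' s' where t: "word_type ks = (k', n', s')" by (cases "word_type ks")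
  have IH: "s' \<le> n'" "n' + s' \<le> k'" "word_weight x y w ks = x ^ (k' - n' - s') * y ^ (n' - s') * w ^ s'"
    using Cons.IH[OF _ t] Cons.prems by auto
  have kn: "k = a + k'" "n = Suc n'" "s = (if 2 \<le> a then Suc s' else s')"
    using Cons.prems(2) t by (auto simp: word_type_def)
  show ?case
  proof (cases "a = 1")
    case True
    then show ?thesis using IH kn by (simp add: entry_weight_def Suc_diff_le)
  next
    case False
    then have a: "2 \<le> a" using Cons.prems(1) by simp
    then have e: "k - n - s = (a - 2) + (k' - n' - s')" using kn IH(1,2) by simp
    have "x ^ (k - n - s) = x ^ (a - 2) * x ^ (k' - n' - s')"
      unfolding e by (rule power_add)
    then have "word_weight x y w (a # ks) = x ^ (k - n - s) * y ^ (n - s) * w ^ s"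
      using a by (simp add: IH(3) kn entry_weight_def)
    then show ?thesis using IH(1,2) kn a by simp
  qed
qed (auto simp: word_type_def)

lemma admissible_weight_eq:
  assumes "ks \<in> admissible_words" "word_type ks = (k, n, s)"
  shows "(k, n, s) \<in> index_triples \<and>
    admissible_weight x y w ks = x ^ (k - n - s) * y ^ (n - s) * w ^ (s - 1)"
proof -
  obtain a as where ks: "ks = a # as" "2 \<le> a" "as \<in> positive_words"
    using assms(1) by (auto simp: admissible_words_def)
  obtain k' n' s' where t: "word_type as = (k', n', s')" by (cases "word_type as")
  have kn: "k = a + k'" "n = Suc n'" "s = Suc s'"
    using assms(2) t ks by (auto simp: word_type_def)
  have W: "s' \<le> n'" "n' + s' \<le> k'" "word_weight x y w as = x ^ (k' - n' - s') * y ^ (n' - s') * w ^ s'"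
    using word_weight_eq[OF ks(3) t] by auto
  have e: "k - n - s = (a - 2) + (k' - n' - s')" using kn W(1,2) ks(2) by simp
  have "admissible_weight x y w ks = x ^ (k - n - s) * y ^ (n - s) * w ^ (s - 1)"
    unfolding e by (simp add: ks(1) W(3) kn power_add)
  then show ?thesis using W kn ks(2) by (simp add: index_triples_def)
qed

text \<open>The types partition the admissible words into finite classes, so an unconditional sum
  may be taken class by class.\<close>

lemma has_sum_index_triples:
  fixes f :: "nat list \<Rightarrow> 'b::banach"
  assumes "f summable_on admissible_words"
  shows "((\<lambda>t. \<Sum>ks\<in>words_of_type t. f ks) has_sum (\<Sum>\<^sub>\<infinity>ks\<in>admissible_words. f ks)) index_triples"
proof -
  have "bij_betw snd (Sigma index_triples words_of_type) admissible_words"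
  proof (rule bij_betwI[where g = "\<lambda>ks. (word_type ks, ks)"])
    show "(\<lambda>ks. (word_type ks, ks)) \<in> admissible_words \<rightarrow> Sigma index_triples words_of_type"
    proof
      fix ks assume ks: "ks \<in> admissible_words"
      then have "word_type ks \<in> index_triples"
        using admissible_weight_eq by (cases "word_type ks") auto
      then show "(word_type ks, ks) \<in> Sigma index_triples words_of_type"
        using ks words_of_type_eq by auto
    qed
  qed (auto simp: words_of_type_eq)
  then have "((\<lambda>z. f (snd z)) has_sum (\<Sum>\<^sub>\<infinity>ks\<in>admissible_words. f ks)) (Sigma index_triples words_of_type)"
    using has_sum_infsum[OF assms] by (subst has_sum_reindex_bij_betw) auto
  then show ?thesis
    by (rule has_sum_SigmaD) (simp add: finite_words_of_type)
qed

subsection \<open>Continuation and uniform bounds\<close>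

text \<open>By the mean value estimate \<open>f\<close> varies by at most
  \<open>2 * C * L * (2 * r)\<close>, hence by at most \<open>C\<close>. In the application
  \<open>2 * C\<close> bounds the previous polylogarithm and \<open>L\<close> the differential form,
  so the bound \<open>2 * C\<close> reproduces itself.\<close>

lemma lipschitz_doubling:
  fixes f f' :: "complex \<Rightarrow> complex"
  assumes der: "\<And>x. x \<in> ball c r \<Longrightarrow> (f has_field_derivative f' x) (at x)"
    and bd: "\<And>x. x \<in> ball c r \<Longrightarrow> norm (f' x) \<le> 2 * C * L"
    and L: "L * (2 * r) \<le> 1 / 2" "0 \<le> L" "0 \<le> C"
    and ab: "a \<in> ball c r" "b \<in> ball c r" and fa: "norm (f a) \<le> C"
  shows "norm (f b) \<le> 2 * C"
proof -
  have "norm (f b - f a) \<le> (2 * C * L) * norm (b - a)"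
    by (rule field_differentiable_bound[OF convex_ball _ bd ab(2,1)])
      (auto intro!: has_field_derivative_at_within der)
  also have "\<dots> \<le> (2 * C * L) * (2 * r)"
  proof (rule mult_left_mono)
    have "dist a b \<le> dist c a + dist c b" by (rule dist_triangle3)
    then show "norm (b - a) \<le> 2 * r" using ab by (simp add: dist_norm norm_minus_commute)
  qed (use L in simp)
  also have "\<dots> = 2 * C * (L * (2 * r))" by simp
  also have "\<dots> \<le> 2 * C * (1 / 2)" using L by (intro mult_left_mono) auto
  finally have "norm (f b - f a) \<le> C" by simp
  then show ?thesis using fa norm_triangle_sub[of "f b" "f a"] by linarith
qed

locale polylog_covering = complex_covering U p "- {0, 1}"
  for U :: "'u::topological_space set" and p :: "'u \<Rightarrow> complex" +
  fixes l :: "real \<Rightarrow> 'u"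
  assumes lift: "unit_interval_lift U p l"
begin

section \<open>Continuation of the polylogarithms to the covering space\<close>

definition Li :: "nat list \<Rightarrow> 'u \<Rightarrow> complex" where
  "Li ks = continuation U p l (mpolylog ks)"

lemma l_in_U: "0 < t \<Longrightarrow> t < 1 \<Longrightarrow> l t \<in> U"
  using lift unfolding unit_interval_lift_def by force

lemma is_continuation_one: "is_continuation U p l (mpolylog []) (\<lambda>_. 1)"
  unfolding is_continuation_def mpolylog_Nil
  by (auto intro!: holomorphic_on_coveringI simp: comp_def)

lemma continuation_primitive_One:
  assumes "ks \<in> positive_words" "is_continuation U p l (mpolylog ks) h"
  shows "\<exists>F. is_continuation U p l (mpolylog (1 # ks)) F \<and> covering_primitive F h (\<lambda>z. 1 / (1 - z))"
proof (rule continuation_primitive[OF lift assms(2)])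
  show "(\<lambda>z. 1 / (1 - z)) holomorphic_on - {0, 1}" by (intro holomorphic_intros) auto
  fix t :: real assume "0 < t" "t < 1"
  then show "(mpolylog (1 # ks) has_field_derivative mpolylog ks (of_real t) * (1 / (1 - of_real t))) (at (of_real t))"
    by (intro mpolylog_derivative_One assms) auto
qed

lemma continuation_primitive_Suc:
  assumes "k # ks \<in> positive_words" "is_continuation U p l (mpolylog (k # ks)) h"
  shows "\<exists>F. is_continuation U p l (mpolylog (Suc k # ks)) F \<and> covering_primitive F h (\<lambda>z. 1 / z)"
proof (rule continuation_primitive[OF lift assms(2)])
  show "(\<lambda>z. 1 / z) holomorphic_on - {0, 1 :: complex}" by (intro holomorphic_intros) auto
  fix t :: real assume "0 < t" "t < 1"
  then show "(mpolylog (Suc k # ks) has_field_derivative mpolylog (k # ks) (of_real t) * (1 / of_real t)) (at (of_real t))"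
    by (intro mpolylog_derivative_Suc assms) auto
qed

lemma Li_is_continuation:
  assumes "ks \<in> positive_words"
  shows "is_continuation U p l (mpolylog ks) (Li ks)"
proof -
  have "\<exists>g. is_continuation U p l (mpolylog ks) g"
    using assms
  proof (induction rule: positive_words_induct)
    case Nil
    then show ?case using is_continuation_one by blast
  next
    case (One ks)
    then show ?case using continuation_primitive_One by blast
  next
    case (Suc k ks)
    then show ?case using continuation_primitive_Suc by blast
  qed
  then show ?thesis unfolding Li_def using continuation_eqI(1)[OF lift] by blast
qed

lemma Li_eq:
  assumes "is_continuation U p l (mpolylog ks) g" "u \<in> U"
  shows "Li ks u = g u"
  unfolding Li_def by (rule continuation_eqI(2)[OF lift assms])

lemma Li_holomorphic: "ks \<in> positive_words \<Longrightarrow> holomorphic_on_covering U p (Li ks)"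
  using Li_is_continuation unfolding is_continuation_def by blast

lemma Li_lift: "ks \<in> positive_words \<Longrightarrow> 0 < t \<Longrightarrow> t < 1 \<Longrightarrow> Li ks (l t) = mpolylog ks (of_real t)"
  using Li_is_continuation unfolding is_continuation_def by auto

lemma Li_primitive_One:
  assumes "ks \<in> positive_words"
  shows "covering_primitive (Li (1 # ks)) (Li ks) (\<lambda>z. 1 / (1 - z))"
proof -
  obtain F where F: "is_continuation U p l (mpolylog (1 # ks)) F" "covering_primitive F (Li ks) (\<lambda>z. 1 / (1 - z))"
    using continuation_primitive_One[OF assms Li_is_continuation[OF assms]] by blast
  show ?thesis by (rule covering_primitive_cong[OF F(2) Li_eq[OF F(1), symmetric] refl])
qed

lemma Li_primitive_Suc:
  assumes "k # ks \<in> positive_words"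
  shows "covering_primitive (Li (Suc k # ks)) (Li (k # ks)) (\<lambda>z. 1 / z)"
proof -
  obtain F where F: "is_continuation U p l (mpolylog (Suc k # ks)) F" "covering_primitive F (Li (k # ks)) (\<lambda>z. 1 / z)"
    using continuation_primitive_Suc[OF assms Li_is_continuation[OF assms]] by blast
  show ?thesis by (rule covering_primitive_cong[OF F(2) Li_eq[OF F(1), symmetric] refl])
qed

lemma continuation_mpolylog_series:
  assumes "ks \<in> positive_words" "ks \<noteq> []"
  shows "continuation U p l (mpolylog_series ks) = Li ks"
  unfolding Li_def by (rule continuation_cong) (simp add: mpolylog_series_eq assms)

text \<open>On a disc so small that \<open>dz/z\<close> and \<open>dz/(1-z)\<close> have integrals at most \<open>1/2\<close>, a common bound
  for all words at one point doubles at worst; the bound survives the induction on the word because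
  it does not depend on the word.\<close>
lemma Li_bound_chart:
  assumes ch: "chart V c r q"
    and L: "\<And>z. z \<in> ball c r \<Longrightarrow> norm (1 / z) \<le> L \<and> norm (1 / (1 - z)) \<le> L" "L * (2 * r) \<le> 1 / 2"
    and v: "v \<in> V" "\<And>ks. ks \<in> positive_words \<Longrightarrow> norm (Li ks v) \<le> C"
    and ks: "ks \<in> positive_words" and u: "u \<in> V"
  shows "norm (Li ks u) \<le> 2 * C"
proof -
  have VU: "V \<subseteq> U" by (rule chart_subset[OF ch])
  have one: "Li [] u = 1" if "u \<in> V" for u using Li_eq[OF is_continuation_one] that VU by blast
  \<comment> \<open>The empty word has value \<open>1\<close>, which forces
    \<open>C \<ge> 1\<close>; the base case of the induction relies on it.\<close>
  have "1 \<le> C" using v(2)[of "[]"] one[OF v(1)] by simp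
  then have C: "0 \<le> C" by simp
  have "norm (1 / p v) \<le> L" using L(1) chart_p[OF ch v(1)] by blast
  then have "0 \<le> L" using norm_ge_zero order_trans by blast
  \<comment> \<open>The inductive step for either form: \<open>h\<close> is the previous
    polylogarithm with the bound \<open>2 * C\<close> on the sheet, while \<open>F\<close> is known
    to be at most \<open>C\<close> at \<open>v\<close>.\<close>
  have step: "norm (F u) \<le> 2 * C"
    if F: "covering_primitive F h R" and h: "\<And>u. u \<in> V \<Longrightarrow> norm (h u) \<le> 2 * C"
      and R: "\<And>z. z \<in> ball c r \<Longrightarrow> norm (R z) \<le> L" and Fv: "norm (F v) \<le> C" and u: "u \<in> V" for F h R u
  proof -
    have "norm ((F \<circ> q) (p u)) \<le> 2 * C"
    proof (rule lipschitz_doubling[OF _ _ L(2) \<open>0 \<le> L\<close> C, of c "F \<circ> q" "\<lambda>x. h (q x) * R x" "p v"])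
      fix x assume x: "x \<in> ball c r"
      show "(F \<circ> q has_field_derivative h (q x) * R x) (at x)"
        using F ch x unfolding covering_primitive_def by blast
      show "norm (h (q x) * R x) \<le> 2 * C * L"
        unfolding norm_mult using h R x chart_q[OF ch x] C by (intro mult_mono) auto
    qed (use chart_p[OF ch v(1)] chart_p[OF ch u] Fv in auto)
    then show ?thesis using chart_p[OF ch u] by simp
  qed
  show ?thesis using ks u
  proof (induction arbitrary: u rule: positive_words_induct)
    case Nil
    then show ?case using one \<open>1 \<le> C\<close> by simp
  next
    case (One ks)
    show ?case
      by (rule step[OF Li_primitive_One]) (use One L(1) v(2) in auto)
  next
    case (Suc k ks)
    show ?case
      by (rule step[OF Li_primitive_Suc]) (use Suc L(1) v(2) in auto)
  qed
qed

section \<open>Common bounds for all polylogarithms\<close>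

lemma small_chart_exists:
  assumes "u \<in> U"
  obtains V c r q L where "u \<in> V" "chart V c r q"
    "\<And>z. z \<in> ball c r \<Longrightarrow> norm (1 / z) \<le> L \<and> norm (1 / (1 - z)) \<le> L" "L * (2 * r) \<le> 1 / 2"
proof -
  have "p u \<in> - {0, 1}" using assms covering_space_imp_surjective[OF covering] by blast
  define d where "d = min (norm (p u)) (norm (1 - p u))"
  have d: "d > 0" using \<open>p u \<in> - {0, 1}\<close> by (auto simp: d_def)
  have d2: "d \<le> norm (p u)" "d \<le> norm (1 - p u)" by (auto simp: d_def)
  \<comment> \<open>On a disc of radius at most \<open>d / 8\<close> both denominators stay above
    \<open>d / 2\<close>, so \<open>L = 2 / d\<close> works and
    \<open>L * (2 * r) \<le> 1 / 2\<close>.\<close>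
  obtain V r q where ch: "0 < r" "r \<le> d / 8" "u \<in> V" "chart V (p u) r q"
    using chart_exists[OF assms, of "d / 8"] d by (metis divide_pos_pos zero_less_numeral)
  show thesis
  proof (rule that[OF ch(3,4)])
    show "norm (1 / z) \<le> 2 / d \<and> norm (1 / (1 - z)) \<le> 2 / d" if z: "z \<in> ball (p u) r" for z
    proof -
      have *: "norm (p u - z) < d / 8" using z ch(2) by (simp add: dist_norm)
      have "norm (p u) - norm (p u - z) \<le> norm z"
        using norm_triangle_ineq[of z "p u - z"] by simp
      then have 1: "d / 2 \<le> norm z" using * d d2 by linarith
      have "norm (1 - p u) - norm (p u - z) \<le> norm (1 - z)"
        using norm_triangle_ineq4[of "1 - z" "p u - z"] by simp
      then have 2: "d / 2 \<le> norm (1 - z)" using * d d2 by linarith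
      have "1 / norm z \<le> 1 / (d / 2)" "1 / norm (1 - z) \<le> 1 / (d / 2)"
        using 1 2 d by (intro divide_left_mono mult_pos_pos; linarith)+
      then show ?thesis by (simp add: norm_divide)
    qed
    have "2 / d * (2 * r) \<le> 2 / d * (2 * (d / 8))" using ch(2) d by (intro mult_left_mono) auto
    then show "2 / d * (2 * r) \<le> 1 / 2" using d by simp
  qed
qed

text \<open>A common bound at one point of a small chart gives one at every other point of it, so
  its existence propagates over the connected \<open>U\<close>.\<close>

lemma Li_pointwise_bounded:
  assumes "u \<in> U"
  shows "\<exists>C. \<forall>ks\<in>positive_words. norm (Li ks u) \<le> C"
proof (rule connected_induction_simple[OF connected_U l_in_U[of "1/2"] assms])
  show "\<exists>C. \<forall>ks\<in>positive_words. norm (Li ks (l (1/2))) \<le> C"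
  proof (intro exI ballI)
    fix ks assume ks: "ks \<in> positive_words"
    \<comment> \<open>The value \<open>1 / (1 - 1/2)\<close> of the geometric majorant.\<close>
    show "norm (Li ks (l (1/2))) \<le> 2"
      using norm_mpolylog_le[OF ks, of "of_real (1/2)"] Li_lift[OF ks, of "1/2"] by (simp add: norm_divide)
  qed
next
  fix a assume "a \<in> U"
  then obtain V c r q L where ch: "a \<in> V" "chart V c r q"
    "\<And>z. z \<in> ball c r \<Longrightarrow> norm (1 / z) \<le> L \<and> norm (1 / (1 - z)) \<le> L" "L * (2 * r) \<le> 1 / 2"
    using small_chart_exists by metis
  have "\<exists>C. \<forall>ks\<in>positive_words. norm (Li ks y) \<le> C"
    if x: "x \<in> V" "\<exists>C. \<forall>ks\<in>positive_words. norm (Li ks x) \<le> C" and y: "y \<in> V" for x y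
  proof -
    obtain C where C: "\<And>ks. ks \<in> positive_words \<Longrightarrow> norm (Li ks x) \<le> C" using x(2) by blast
    have "norm (Li ks y) \<le> 2 * C" if "ks \<in> positive_words" for ks
      by (rule Li_bound_chart[OF ch(2,3,4) x(1) C that y])
    then show ?thesis by blast
  qed
  then show "\<exists>T. openin (top_of_set U) T \<and> a \<in> T \<and> (\<forall>x\<in>T. \<forall>y\<in>T.
      (\<exists>C. \<forall>ks\<in>positive_words. norm (Li ks x) \<le> C) \<longrightarrow> (\<exists>C. \<forall>ks\<in>positive_words. norm (Li ks y) \<le> C))"
    by (intro exI[of _ V] conjI ballI impI ch(1) chart_openin[OF ch(2)])
qed auto

theorem Li_bounded_on_compact:
  assumes "compact K" "K \<subseteq> U"
  obtains C where "0 \<le> C" "\<And>ks u. ks \<in> positive_words \<Longrightarrow> u \<in> K \<Longrightarrow> norm (Li ks u) \<le> C"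
proof -
  have "\<exists>W C. open W \<and> u \<in> W \<and> (\<forall>v\<in>U \<inter> W. \<forall>ks\<in>positive_words. norm (Li ks v) \<le> C)" if u: "u \<in> U" for u
  proof -
    obtain V c r q L where ch: "u \<in> V" "chart V c r q"
      "\<And>z. z \<in> ball c r \<Longrightarrow> norm (1 / z) \<le> L \<and> norm (1 / (1 - z)) \<le> L" "L * (2 * r) \<le> 1 / 2"
      using small_chart_exists[OF u] by metis
    obtain C where C: "\<And>ks. ks \<in> positive_words \<Longrightarrow> norm (Li ks u) \<le> C"
      using Li_pointwise_bounded[OF u] by blast
    obtain W where "open W" "V = U \<inter> W" using chart_openin[OF ch(2)] by (auto simp: openin_open)
    moreover have "norm (Li ks v) \<le> 2 * C" if "v \<in> V" "ks \<in> positive_words" for ks v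
      by (rule Li_bound_chart[OF ch(2,3,4,1) C that(2,1)])
    ultimately show ?thesis using ch(1) by (intro exI[of _ W] exI[of _ "2 * C"]) auto
  qed
  then obtain W C where W: "\<And>u. u \<in> U \<Longrightarrow> open (W u)" "\<And>u. u \<in> U \<Longrightarrow> u \<in> W u"
    "\<And>u v ks. u \<in> U \<Longrightarrow> v \<in> U \<Longrightarrow> v \<in> W u \<Longrightarrow> ks \<in> positive_words \<Longrightarrow> norm (Li ks v) \<le> C u"
    by (metis IntI)
  obtain D where D: "D \<subseteq> K" "finite D" "K \<subseteq> (\<Union>u\<in>D. W u)"
  proof (rule compactE_image[OF assms(1), of K W])
    show "open (W u)" if "u \<in> K" for u using W(1) assms(2) that by auto
    show "K \<subseteq> (\<Union>u\<in>K. W u)" using W(2) assms(2) by auto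
  qed
  show thesis
  proof (rule that)
    \<comment> \<open>A sum of absolute values instead of a maximum, which also covers an empty
      \<open>D\<close>.\<close>
    show "0 \<le> (\<Sum>u\<in>D. \<bar>C u\<bar>)" by (intro sum_nonneg) auto
    fix ks v assume ks: "ks \<in> positive_words" and v: "v \<in> K"
    then obtain u where u: "u \<in> D" "v \<in> W u" using D by blast
    then have "norm (Li ks v) \<le> C u" using W(3) D(1) assms(2) v ks by blast
    also have "\<dots> \<le> (\<Sum>u\<in>D. \<bar>C u\<bar>)" using member_le_sum[of u D "\<lambda>u. \<bar>C u\<bar>"] u D(2) by auto
    finally show "norm (Li ks v) \<le> (\<Sum>u\<in>D. \<bar>C u\<bar>)" .
  qed
qed

section \<open>Convergence of the series and its identification with the Gauss function\<close>

context
  fixes \<alpha> \<beta> \<gamma> :: complex and x y w :: complex and r :: real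
  defines "x \<equiv> 1 - \<gamma>" and "y \<equiv> \<alpha> + \<beta> + 1 - \<gamma>" and "w \<equiv> (\<alpha> + 1 - \<gamma>) * (\<beta> + 1 - \<gamma>)"
  assumes r: "0 < r" "r < 1/2" "norm x \<le> r" "norm y \<le> r" "norm w \<le> r\<^sup>2"
begin

lemma G0_term_eq:
  assumes "t \<in> index_triples"
  shows "G0_term U p l \<alpha> \<beta> \<gamma> u t = (\<Sum>ks\<in>words_of_type t. admissible_weight x y w ks * Li ks u)"
proof -
  obtain k n s where t: "t = (k, n, s)" by (cases t)
  have "continuation U p l (mpolylog_series ks) u * x ^ (k - n - s) * y ^ (n - s) * w ^ (s - 1)
      = admissible_weight x y w ks * Li ks u" if ks: "ks \<in> words_of_type t" for ks
  proof -
    have ks': "ks \<in> admissible_words" "word_type ks = (k, n, s)"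
      using ks words_of_type_eq[OF assms] t by auto
    then have "ks \<in> positive_words" "ks \<noteq> []" using admissible_words_subset by (auto simp: admissible_words_def)
    then show ?thesis
      using admissible_weight_eq[OF ks', of x y w] continuation_mpolylog_series[of ks] by (simp add: mult_ac)
  qed
  then show ?thesis
    by (simp add: G0_term_def G0_def t words_of_type_def sum_distrib_right x_def y_def w_def)
qed

text \<open>The majorant over words, \<open>C\<close> times the weight bound, is summed within each
  type. Summability over words is recorded too, since the regrouping needs it.\<close>

lemma G0_term_bound:
  assumes K: "compact K" "K \<subseteq> U"
  obtains M where "M summable_on index_triples"
    "\<And>t u. t \<in> index_triples \<Longrightarrow> u \<in> K \<Longrightarrow> norm (G0_term U p l \<alpha> \<beta> \<gamma> u t) \<le> M t"
    "\<And>u. u \<in> K \<Longrightarrow> (\<lambda>ks. admissible_weight x y w ks * Li ks u) summable_on admissible_words"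
proof -
  obtain C where C: "0 \<le> C" "\<And>ks u. ks \<in> positive_words \<Longrightarrow> u \<in> K \<Longrightarrow> norm (Li ks u) \<le> C"
    using Li_bounded_on_compact[OF K] by blast
  define B where "B ks = r ^ sum_list ks / r\<^sup>2 * C" for ks
  have B: "B summable_on admissible_words"
    unfolding B_def by (intro summable_on_cmult_left summable_admissible_words) (use r in auto)
  have le: "norm (admissible_weight x y w ks * Li ks u) \<le> B ks" if "ks \<in> admissible_words" "u \<in> K" for ks u
    unfolding norm_mult B_def
    using that r C admissible_words_subset by (intro mult_mono norm_admissible_weight_le) auto
  show thesis
  proof (rule that)
    show "(\<lambda>t. \<Sum>ks\<in>words_of_type t. B ks) summable_on index_triples"
      using has_sum_index_triples[OF B] by (rule has_sum_imp_summable)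
    show "norm (G0_term U p l \<alpha> \<beta> \<gamma> u t) \<le> (\<Sum>ks\<in>words_of_type t. B ks)"
      if "t \<in> index_triples" "u \<in> K" for t u
      unfolding G0_term_eq[OF that(1)]
      by (rule sum_norm_le) (use le that words_of_type_eq in auto)
    show "(\<lambda>ks. admissible_weight x y w ks * Li ks u) summable_on admissible_words" if "u \<in> K" for u
    proof (rule abs_summable_summable)
      show "(\<lambda>ks. norm (admissible_weight x y w ks * Li ks u)) summable_on admissible_words"
        by (rule summable_on_comparison_test[OF B]) (use le that in auto)
    qed
  qed
qed

lemma G0_term_uniform_limit:
  assumes K: "compact K" "K \<subseteq> U"
  shows "\<forall>u\<in>K. (\<lambda>t. norm (G0_term U p l \<alpha> \<beta> \<gamma> u t)) summable_on index_triples"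
    and "uniform_limit K (\<lambda>T u. \<Sum>t\<in>T. G0_term U p l \<alpha> \<beta> \<gamma> u t)
              (\<lambda>u. \<Sum>\<^sub>\<infinity>t\<in>index_triples. G0_term U p l \<alpha> \<beta> \<gamma> u t) (finite_subsets_at_top index_triples)"
proof -
  obtain M where M: "M summable_on index_triples"
    "\<And>t u. t \<in> index_triples \<Longrightarrow> u \<in> K \<Longrightarrow> norm (G0_term U p l \<alpha> \<beta> \<gamma> u t) \<le> M t"
    using G0_term_bound[OF K] by metis
  show "\<forall>u\<in>K. (\<lambda>t. norm (G0_term U p l \<alpha> \<beta> \<gamma> u t)) summable_on index_triples"
    using summable_on_comparison_test[OF M(1)] M(2) by simp
  show "uniform_limit K (\<lambda>T u. \<Sum>t\<in>T. G0_term U p l \<alpha> \<beta> \<gamma> u t)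
              (\<lambda>u. \<Sum>\<^sub>\<infinity>t\<in>index_triples. G0_term U p l \<alpha> \<beta> \<gamma> u t) (finite_subsets_at_top index_triples)"
    by (rule Weierstrass_m_test_general[OF M(2) M(1)])
qed

lemma infsum_G0_term:
  assumes u: "u \<in> U"
  shows "(\<Sum>\<^sub>\<infinity>t\<in>index_triples. G0_term U p l \<alpha> \<beta> \<gamma> u t)
    = (\<Sum>\<^sub>\<infinity>ks\<in>admissible_words. admissible_weight x y w ks * Li ks u)"
proof -
  \<comment> \<open>A singleton is compact, so the bound on compact sets gives summability at
    \<open>u\<close>.\<close>
  have "(\<lambda>ks. admissible_weight x y w ks * Li ks u) summable_on admissible_words"
    using G0_term_bound[of "{u}"] u by auto
  then have "(\<Sum>\<^sub>\<infinity>t\<in>index_triples. \<Sum>ks\<in>words_of_type t. admissible_weight x y w ks * Li ks u)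
    = (\<Sum>\<^sub>\<infinity>ks\<in>admissible_words. admissible_weight x y w ks * Li ks u)"
    by (intro infsumI has_sum_index_triples)
  then show ?thesis by (simp add: G0_term_eq cong: infsum_cong)
qed

text \<open>Closed discs in a chart have compact image in \<open>U\<close>, on which the finite
  partial sums converge uniformly; the limit is therefore holomorphic.\<close>

lemma infsum_G0_term_holomorphic:
  "holomorphic_on_covering U p (\<lambda>u. \<Sum>\<^sub>\<infinity>t\<in>index_triples. G0_term U p l \<alpha> \<beta> \<gamma> u t)" (is "holomorphic_on_covering U p ?H")
proof (rule holomorphic_on_coveringI)
  fix V c \<rho> q assume ch: "chart V c \<rho> q"
  let ?f = "\<lambda>T z. \<Sum>t\<in>T. G0_term U p l \<alpha> \<beta> \<gamma> (q z) t"
  have hol: "?f T holomorphic_on ball c \<rho>" if "T \<subseteq> index_triples" for T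
  proof (intro holomorphic_on_sum)
    fix t assume "t \<in> T"
    then have t: "t \<in> index_triples" using that by blast
    have "(\<lambda>z. admissible_weight x y w ks * (Li ks \<circ> q) z) holomorphic_on ball c \<rho>"
      if "ks \<in> words_of_type t" for ks
    proof -
      have "ks \<in> positive_words" using that t words_of_type_eq admissible_words_subset by blast
      then show ?thesis by (intro holomorphic_on_mult holomorphic_on_const holomorphic_chart[OF ch] Li_holomorphic)
    qed
    then show "(\<lambda>z. G0_term U p l \<alpha> \<beta> \<gamma> (q z) t) holomorphic_on ball c \<rho>"
      unfolding G0_term_eq[OF t] by (intro holomorphic_on_sum) (simp add: comp_def)
  qed
  have "(?H \<circ> q) field_differentiable (at z)" if z: "z \<in> ball c \<rho>" for z
  proof -
    obtain e where e: "e > 0" "cball z e \<subseteq> ball c \<rho>"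
      using open_contains_cball[of "ball c \<rho>"] z open_ball by blast
    have "compact (q ` cball z e)"
      by (intro compact_continuous_image continuous_on_subset[OF chart_continuous_q[OF ch] e(2)] compact_cball)
    moreover have "q ` cball z e \<subseteq> U" using chart_q[OF ch] chart_subset[OF ch] e(2) by blast
    ultimately have "uniform_limit (q ` cball z e) (\<lambda>T u. \<Sum>t\<in>T. G0_term U p l \<alpha> \<beta> \<gamma> u t) ?H
        (finite_subsets_at_top index_triples)"
      by (rule G0_term_uniform_limit(2))
    then have ul: "uniform_limit (cball z e) ?f (?H \<circ> q) (finite_subsets_at_top index_triples)"
      unfolding uniform_limit_iff by simp
    have ev: "eventually (\<lambda>T. continuous_on (cball z e) (?f T) \<and> ?f T holomorphic_on ball z e)
        (finite_subsets_at_top index_triples)"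
    proof (rule eventually_mono[rotated])
      show "eventually (\<lambda>T. T \<subseteq> index_triples) (finite_subsets_at_top index_triples)"
        by (rule eventually_finite_subsets_at_top_weakI)
      fix T assume "T \<subseteq> index_triples"
      then have "?f T holomorphic_on cball z e" using hol holomorphic_on_subset e(2) by blast
      then show "continuous_on (cball z e) (?f T) \<and> ?f T holomorphic_on ball z e"
        using holomorphic_on_imp_continuous_on holomorphic_on_subset ball_subset_cball by blast
    qed
    have "(?H \<circ> q) holomorphic_on ball z e"
      by (rule holomorphic_uniform_limit[OF ev ul]) auto
    then show ?thesis using e(1) holomorphic_on_imp_differentiable_at[OF _ open_ball] by auto
  qed
  then show "(?H \<circ> q) holomorphic_on ball c \<rho>"
    unfolding holomorphic_on_def using field_differentiable_at_within by blast
qed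

text \<open>The right-hand side is holomorphic and equals the Gauss series on the lift, so it is
  itself the continuation; the existence of the latter needs no argument of its own.\<close>

lemma continuation_gauss_series:
  assumes "u \<in> U"
  shows "continuation U p l (gauss_series \<alpha> \<beta> \<gamma>) u =
    1 + \<alpha> * \<beta> * (\<Sum>\<^sub>\<infinity>t\<in>index_triples. G0_term U p l \<alpha> \<beta> \<gamma> u t)"
proof (rule continuation_eqI(2)[OF lift _ assms])
  let ?R = "\<lambda>u. 1 + \<alpha> * \<beta> * (\<Sum>\<^sub>\<infinity>t\<in>index_triples. G0_term U p l \<alpha> \<beta> \<gamma> u t)"
  have "holomorphic_on_covering U p ?R"
  proof (rule holomorphic_on_coveringI)
    fix V c \<rho> q assume ch: "chart V c \<rho> q"
    show "(?R \<circ> q) holomorphic_on ball c \<rho>"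
      using holomorphic_chart[OF ch infsum_G0_term_holomorphic]
      unfolding comp_def by (intro holomorphic_intros)
  qed
  moreover have "?R (l t) = gauss_series \<alpha> \<beta> \<gamma> (of_real t)" if t: "0 < t" "t < 1" for t
  proof -
    have "(\<Sum>\<^sub>\<infinity>ks\<in>admissible_words. admissible_weight x y w ks * Li ks (l t))
      = (\<Sum>\<^sub>\<infinity>ks\<in>admissible_words. admissible_weight x y w ks * mpolylog ks (of_real t))"
      using admissible_words_subset t by (intro infsum_cong) (auto simp: Li_lift)
    then show ?thesis
      using gauss_series_eq_words[of r \<gamma> \<alpha> \<beta> "of_real t"] r t infsum_G0_term[OF l_in_U[OF t]]
      unfolding x_def y_def w_def by simp
  qed
  ultimately show "is_continuation U p l (gauss_series \<alpha> \<beta> \<gamma>) ?R"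
    unfolding is_continuation_def by simp
qed

end

end

theorem theorem5:
  fixes U :: "'u::topological_space set" and p :: "'u \<Rightarrow> complex" and l :: "real \<Rightarrow> 'u"
    and \<alpha> \<beta> \<gamma> :: complex
  assumes "universal_covering U p (- {0, 1})"
    and "unit_interval_lift U p l"
    and "norm (1 - \<gamma>) < 1 / 2"
    and "norm (\<alpha> + 1 - \<gamma>) < 1 / 2"
    and "norm (\<beta> + 1 - \<gamma>) < 1 / 2"
    and "norm (\<alpha> + \<beta> + 1 - \<gamma>) < 1 / 2"
  shows "(\<forall>z\<in>U. continuation U p l (gauss_series \<alpha> \<beta> \<gamma>) z =
            1 + \<alpha> * \<beta> * (\<Sum>\<^sub>\<infinity>t\<in>index_triples. G0_term U p l \<alpha> \<beta> \<gamma> z t))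
       \<and> (\<forall>K. K \<subseteq> U \<and> compact K \<longrightarrow>
            (\<forall>z\<in>K. (\<lambda>t. norm (G0_term U p l \<alpha> \<beta> \<gamma> z t)) summable_on index_triples)
          \<and> uniform_limit K (\<lambda>T z. \<Sum>t\<in>T. G0_term U p l \<alpha> \<beta> \<gamma> z t)
              (\<lambda>z. \<Sum>\<^sub>\<infinity>t\<in>index_triples. G0_term U p l \<alpha> \<beta> \<gamma> z t)
              (finite_subsets_at_top index_triples))"
proof -
  interpret polylog_covering U p l
    by unfold_locales (use assms(1,2) in \<open>auto simp: universal_covering_def intro!: finite_imp_closed\<close>)
  \<comment> \<open>The entry \<open>1/4\<close> keeps \<open>r\<close> positive, as the estimates
    divide by \<open>r\<^sup>2\<close>; the strict inequalities leave the maximum below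
    \<open>1/2\<close>.\<close>
  define r where "r = Max {1/4, norm (1 - \<gamma>), norm (\<alpha> + 1 - \<gamma>), norm (\<beta> + 1 - \<gamma>), norm (\<alpha> + \<beta> + 1 - \<gamma>)}"
  have r: "1/4 \<le> r" "norm (1 - \<gamma>) \<le> r" "norm (\<alpha> + 1 - \<gamma>) \<le> r" "norm (\<beta> + 1 - \<gamma>) \<le> r"
      "norm (\<alpha> + \<beta> + 1 - \<gamma>) \<le> r"
    unfolding r_def by (intro Max_ge; simp)+
  have r2: "r < 1/2" unfolding r_def using assms(3-6) by simp
  have "norm ((\<alpha> + 1 - \<gamma>) * (\<beta> + 1 - \<gamma>)) \<le> r\<^sup>2"
    unfolding norm_mult power2_eq_square using r by (intro mult_mono) auto
  with r r2 have *: "0 < r" "r < 1/2" "norm (1 - \<gamma>) \<le> r" "norm (\<alpha> + \<beta> + 1 - \<gamma>) \<le> r"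
      "norm ((\<alpha> + 1 - \<gamma>) * (\<beta> + 1 - \<gamma>)) \<le> r\<^sup>2" by auto
  show ?thesis
    using continuation_gauss_series[OF *] G0_term_uniform_limit[OF *] by blast
qed

end
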